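(* Let $(M,I,J,K,g_M)$ be a hyperkähler manifold, $(N,g_N)$ a Riemannian manifold, and $F:(M,g_M)\to(N,g_N)$ a h-anti-invariant submersion such that $(I,J,K)$ is a h-anti-invariant basis, i.e. $F$ is a Riemannian submersion with $R(\ker F_* )\subset(\ker F_* )^{\perp}$ for each $R\in\{I,J,K\}$. Then the following conditions are equivalent: a) the distribution $(\ker F_* )^{\perp}$ defines a totally geodesic foliation on $M$; b) $g_M(\mathcal{A}_X B_I Y, IV)=g_M(C_I Y, I\mathcal{A}_X V)$ for all $V\in\Gamma(\ker F_* )$ and $X,Y\in\Gamma((\ker F_* )^{\perp})$; c) $g_M(\mathcal{A}_X B_J Y, JV)=g_M(C_J Y, J\mathcal{A}_X V)$ for all $V\in\Gamma(\ker F_* )$ and $X,Y\in\Gamma((\ker F_* )^{\perp})$; d) $g_M(\mathcal{A}_X B_K Y, KV)=g_M(C_K Y, K\mathcal{A}_X V)$ for all $V\in\Gamma(\ker F_* )$ and $X,Y\in\Gamma((\ker F_* )^{\perp})$.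
   Context: A hyperkähler manifold $(M,I,J,K,g_M)$ is a $4m$-dimensional Riemannian manifold with endomorphism fields $I,J,K$ of $TM$ satisfying $I^2=J^2=K^2=-\mathrm{id}$, $IJ=-JI=K$, $JK=-KJ=I$, $KI=-IK=J$, $g_M(RX,RY)=g_M(X,Y)$ for $R\in\{I,J,K\}$, and $\nabla I=\nabla J=\nabla K=0$, where $\nabla$ is the Levi-Civita connection of $g_M$. A Riemannian submersion $F:(M,g_M)\to(N,g_N)$ is a smooth surjective submersion such that $(F_* )_p:(\ker (F_* )_p)^{\perp}\to T_{F(p)}N$ is a linear isometry for every $p\in M$. For a vector field $U$ on $M$ write $U=\mathcal{V}U+\mathcal{H}U$ with $\mathcal{V}U\in\Gamma(\ker F_* )$ and $\mathcal{H}U\in\Gamma((\ker F_* )^{\perp})$. The O'Neill tensor $\mathcal{A}$ is $$\mathcal{A}_U W=\mathcal{H}\nabla_{\mathcal{H}U}\mathcal{V}W+\mathcal{V}\nabla_{\mathcal{H}U}\mathcal{H}W .$$ For $X\in\Gamma((\ker F_* )^{\perp})$ and $R\in\{I,J,K\}$ write $RX=B_RX+C_RX$ with $B_RX\in\Gamma(\ker F_* )$ and $C_RX\in\Gamma((\ker F_* )^{\perp})$. A distribution $\xi\subset TM$ defines a totally geodesic foliation if $\nabla_XY\in\Gamma(\xi)$ for all $X,Y\in\Gamma(\xi)$ (this implies integrability). *)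

theory Defs
  imports "HOL-Analysis.Analysis" "HOL-Library.Function_Algebras"
begin

section \<open>Smooth maps between Euclidean spaces\<close>

text \<open>Only used for open \<open>S\<close>. In finite dimension, a map is of class \<open>C\<^sup>k\<^sup>+\<^sup>1\<close> iff it is
  differentiable and all its directional derivatives are of class \<open>C\<^sup>k\<close>.\<close>

primrec Ck_on :: "nat \<Rightarrow> 'a::real_normed_vector set \<Rightarrow> ('a \<Rightarrow> 'b::real_normed_vector) \<Rightarrow> bool" where
  "Ck_on 0 S f \<longleftrightarrow> continuous_on S f"
| "Ck_on (Suc k) S f \<longleftrightarrow>
     (\<forall>x\<in>S. f differentiable (at x)) \<and> (\<forall>v. Ck_on k S (\<lambda>x. frechet_derivative f (at x) v))"

definition smooth_on :: "'a::real_normed_vector set \<Rightarrow> ('a \<Rightarrow> 'b::real_normed_vector) \<Rightarrow> bool" where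
  "smooth_on S f \<longleftrightarrow> (\<forall>k. Ck_on k S f)"


section \<open>Smooth manifolds and tangent vectors\<close>

text \<open>The underlying set of a manifold is a whole type \<open>'m\<close>; where manifolds are meant to be
  Hausdorff and second countable, this is imposed by the sort of \<open>'m\<close>. A chart is a pair of an
  open domain and a coordinate map; only the values of the coordinate map on the domain matter.\<close>

type_synonym ('m, 'e) chart = "'m set \<times> ('m \<Rightarrow> 'e)"

definition chart_inv :: "('m, 'e) chart \<Rightarrow> 'e \<Rightarrow> 'm" where
  "chart_inv c = inv_into (fst c) (snd c)"

definition smooth_atlas ::
    "('m::topological_space, 'e::euclidean_space) chart set \<Rightarrow> bool" where
  "smooth_atlas A \<longleftrightarrow>
     (\<forall>c\<in>A. open (fst c) \<and> open (snd c ` fst c) \<and>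
        homeomorphism (fst c) (snd c ` fst c) (snd c) (chart_inv c)) \<and>
     (\<Union>c\<in>A. fst c) = UNIV \<and>
     (\<forall>c\<in>A. \<forall>d\<in>A. smooth_on (snd c ` (fst c \<inter> fst d)) (snd d \<circ> chart_inv c))"

definition smooth_fun :: "('m, 'e::euclidean_space) chart set \<Rightarrow> ('m \<Rightarrow> real) \<Rightarrow> bool" where
  "smooth_fun A f \<longleftrightarrow> (\<forall>c\<in>A. smooth_on (snd c ` fst c) (f \<circ> chart_inv c))"

definition smooth_map ::
    "('m::topological_space, 'e::euclidean_space) chart set \<Rightarrow>
     ('n::topological_space, 'f::euclidean_space) chart set \<Rightarrow> ('m \<Rightarrow> 'n) \<Rightarrow> bool" where
  "smooth_map A B F \<longleftrightarrow> continuous_on UNIV F \<and>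
     (\<forall>c\<in>A. \<forall>d\<in>B. smooth_on (snd c ` (fst c \<inter> F -` fst d)) (snd d \<circ> F \<circ> chart_inv c))"

text \<open>A tangent vector at \<open>p\<close> is given by its coordinate vectors \<open>v c\<close> in the charts \<open>c\<close> around
  \<open>p\<close>, which transform by the derivatives of the transition maps. It takes the value 0 on everything
  that is not a chart around \<open>p\<close>, so that equality of tangent vectors is equality of functions.\<close>

type_synonym ('m, 'e) tangent = "('m, 'e) chart \<Rightarrow> 'e"

instantiation "fun" :: (type, real_vector) real_vector
begin

definition scaleR_fun :: "real \<Rightarrow> ('a \<Rightarrow> 'b) \<Rightarrow> 'a \<Rightarrow> 'b" where
  "scaleR_fun r f = (\<lambda>x. r *\<^sub>R f x)"

instance
  by standard (auto simp: scaleR_fun_def plus_fun_def scaleR_add_left scaleR_add_right)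

end

definition tangent_space ::
    "('m, 'e::euclidean_space) chart set \<Rightarrow> 'm \<Rightarrow> ('m, 'e) tangent set" where
  "tangent_space A p = {v.
     (\<forall>c\<in>A. \<forall>d\<in>A. p \<in> fst c \<longrightarrow> p \<in> fst d \<longrightarrow>
        v d = frechet_derivative (snd d \<circ> chart_inv c) (at (snd c p)) (v c)) \<and>
     (\<forall>c. c \<notin> A \<or> p \<notin> fst c \<longrightarrow> v c = 0)}"

definition coord_vector ::
    "('m, 'e::euclidean_space) chart set \<Rightarrow> ('m, 'e) chart \<Rightarrow> 'e \<Rightarrow> 'm \<Rightarrow> ('m, 'e) tangent" where
  "coord_vector A c u p =
     (\<lambda>d. if d \<in> A \<and> p \<in> fst d
          then frechet_derivative (snd d \<circ> chart_inv c) (at (snd c p)) u else 0)"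

text \<open>The differential of a map and the derivative of a function along a tangent vector are
  computed in an arbitrary chart around \<open>p\<close>; by the chain rule its choice is immaterial.\<close>

definition chart_at :: "('m, 'e) chart set \<Rightarrow> 'm \<Rightarrow> ('m, 'e) chart" where
  "chart_at A p = (SOME c. c \<in> A \<and> p \<in> fst c)"

definition pushforward ::
    "('m, 'e::euclidean_space) chart set \<Rightarrow> ('n, 'f::euclidean_space) chart set \<Rightarrow>
     ('m \<Rightarrow> 'n) \<Rightarrow> 'm \<Rightarrow> ('m, 'e) tangent \<Rightarrow> ('n, 'f) tangent" where
  "pushforward A B F p v =
     (let c = chart_at A p in
      (\<lambda>d. if d \<in> B \<and> F p \<in> fst d
           then frechet_derivative (snd d \<circ> F \<circ> chart_inv c) (at (snd c p)) (v c) else 0))"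

definition dir_deriv ::
    "('m, 'e::euclidean_space) chart set \<Rightarrow> ('m \<Rightarrow> real) \<Rightarrow> 'm \<Rightarrow> ('m, 'e) tangent \<Rightarrow> real" where
  "dir_deriv A f p v =
     (let c = chart_at A p in frechet_derivative (f \<circ> chart_inv c) (at (snd c p)) (v c))"


section \<open>Vector fields, distributions, endomorphism fields\<close>

type_synonym ('m, 'e) vfield = "'m \<Rightarrow> ('m, 'e) tangent"

definition vector_fields :: "('m, 'e::euclidean_space) chart set \<Rightarrow> ('m, 'e) vfield set" where
  "vector_fields A = {X. (\<forall>p. X p \<in> tangent_space A p) \<and>
     (\<forall>c\<in>A. smooth_on (snd c ` fst c) (\<lambda>x. X (chart_inv c x) c))}"

definition vf_deriv ::
    "('m, 'e::euclidean_space) chart set \<Rightarrow> ('m, 'e) vfield \<Rightarrow> ('m \<Rightarrow> real) \<Rightarrow> 'm \<Rightarrow> real" where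
  "vf_deriv A X f = (\<lambda>p. dir_deriv A f p (X p))"

definition sections ::
    "('m, 'e::euclidean_space) chart set \<Rightarrow> ('m \<Rightarrow> ('m, 'e) tangent set) \<Rightarrow> ('m, 'e) vfield set" where
  "sections A D = {X \<in> vector_fields A. \<forall>p. X p \<in> D p}"

definition endo_field ::
    "('m, 'e::euclidean_space) chart set \<Rightarrow>
     ('m \<Rightarrow> ('m, 'e) tangent \<Rightarrow> ('m, 'e) tangent) \<Rightarrow> bool" where
  "endo_field A R \<longleftrightarrow>
     (\<forall>p. \<forall>v\<in>tangent_space A p. R p v \<in> tangent_space A p) \<and>
     (\<forall>p. \<forall>v\<in>tangent_space A p. \<forall>w\<in>tangent_space A p. \<forall>a b.
        R p (a *\<^sub>R v + b *\<^sub>R w) = a *\<^sub>R R p v + b *\<^sub>R R p w) \<and>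
     (\<forall>c\<in>A. \<forall>u. smooth_on (snd c ` fst c)
        (\<lambda>x. R (chart_inv c x) (coord_vector A c u (chart_inv c x)) c))"

definition endo_apply ::
    "('m \<Rightarrow> ('m, 'e) tangent \<Rightarrow> ('m, 'e) tangent) \<Rightarrow> ('m, 'e) vfield \<Rightarrow> ('m, 'e) vfield" where
  "endo_apply R X = (\<lambda>p. R p (X p))"


section \<open>Riemannian metrics and the Levi-Civita connection\<close>

definition riemannian_metric ::
    "('m, 'e::euclidean_space) chart set \<Rightarrow>
     ('m \<Rightarrow> ('m, 'e) tangent \<Rightarrow> ('m, 'e) tangent \<Rightarrow> real) \<Rightarrow> bool" where
  "riemannian_metric A g \<longleftrightarrow>
     (\<forall>p. \<forall>u\<in>tangent_space A p. \<forall>v\<in>tangent_space A p. \<forall>w\<in>tangent_space A p. \<forall>a b.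
        g p (a *\<^sub>R u + b *\<^sub>R v) w = a * g p u w + b * g p v w) \<and>
     (\<forall>p. \<forall>v\<in>tangent_space A p. \<forall>w\<in>tangent_space A p. g p v w = g p w v) \<and>
     (\<forall>p. \<forall>v\<in>tangent_space A p. v \<noteq> 0 \<longrightarrow> g p v v > 0) \<and>
     (\<forall>c\<in>A. \<forall>u w. smooth_on (snd c ` fst c)
        (\<lambda>x. g (chart_inv c x) (coord_vector A c u (chart_inv c x))
                               (coord_vector A c w (chart_inv c x))))"

definition riemannian_manifold ::
    "('m::{t2_space, second_countable_topology}, 'e::euclidean_space) chart set \<Rightarrow>
     ('m \<Rightarrow> ('m, 'e) tangent \<Rightarrow> ('m, 'e) tangent \<Rightarrow> real) \<Rightarrow> bool" where
  "riemannian_manifold A g \<longleftrightarrow> smooth_atlas A \<and> riemannian_metric A g"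

definition affine_connection ::
    "('m, 'e::euclidean_space) chart set \<Rightarrow>
     (('m, 'e) vfield \<Rightarrow> ('m, 'e) vfield \<Rightarrow> ('m, 'e) vfield) \<Rightarrow> bool" where
  "affine_connection A nabla \<longleftrightarrow>
     (\<forall>X\<in>vector_fields A. \<forall>Y\<in>vector_fields A. nabla X Y \<in> vector_fields A) \<and>
     (\<forall>X\<in>vector_fields A. \<forall>Y\<in>vector_fields A. \<forall>Z\<in>vector_fields A.
        nabla (X + Y) Z = nabla X Z + nabla Y Z \<and> nabla X (Y + Z) = nabla X Y + nabla X Z) \<and>
     (\<forall>f X Y. smooth_fun A f \<longrightarrow> X \<in> vector_fields A \<longrightarrow> Y \<in> vector_fields A \<longrightarrow>
        nabla (\<lambda>p. f p *\<^sub>R X p) Y = (\<lambda>p. f p *\<^sub>R nabla X Y p) \<and>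
        nabla X (\<lambda>p. f p *\<^sub>R Y p) = (\<lambda>p. vf_deriv A X f p *\<^sub>R Y p + f p *\<^sub>R nabla X Y p))"

text \<open>Torsion-freeness is \<open>\<nabla>\<^sub>X Y - \<nabla>\<^sub>Y X = [X, Y]\<close>, with both sides acting on smooth functions.\<close>

definition levi_civita ::
    "('m, 'e::euclidean_space) chart set \<Rightarrow>
     ('m \<Rightarrow> ('m, 'e) tangent \<Rightarrow> ('m, 'e) tangent \<Rightarrow> real) \<Rightarrow>
     (('m, 'e) vfield \<Rightarrow> ('m, 'e) vfield \<Rightarrow> ('m, 'e) vfield) \<Rightarrow> bool" where
  "levi_civita A g nabla \<longleftrightarrow> affine_connection A nabla \<and>
     (\<forall>X\<in>vector_fields A. \<forall>Y\<in>vector_fields A. \<forall>f. smooth_fun A f \<longrightarrow>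
        vf_deriv A (nabla X Y - nabla Y X) f =
        vf_deriv A X (vf_deriv A Y f) - vf_deriv A Y (vf_deriv A X f)) \<and>
     (\<forall>X\<in>vector_fields A. \<forall>Y\<in>vector_fields A. \<forall>Z\<in>vector_fields A.
        vf_deriv A X (\<lambda>p. g p (Y p) (Z p)) =
        (\<lambda>p. g p (nabla X Y p) (Z p) + g p (Y p) (nabla X Z p)))"

definition totally_geodesic_foliation ::
    "('m, 'e::euclidean_space) chart set \<Rightarrow>
     (('m, 'e) vfield \<Rightarrow> ('m, 'e) vfield \<Rightarrow> ('m, 'e) vfield) \<Rightarrow>
     ('m \<Rightarrow> ('m, 'e) tangent set) \<Rightarrow> bool" where
  "totally_geodesic_foliation A nabla D \<longleftrightarrow>
     (\<forall>X\<in>sections A D. \<forall>Y\<in>sections A D. nabla X Y \<in> sections A D)"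


section \<open>Hyperkaehler manifolds\<close>

definition hyperkahler_manifold ::
    "('m::{t2_space, second_countable_topology}, 'e::euclidean_space) chart set \<Rightarrow>
     ('m \<Rightarrow> ('m, 'e) tangent \<Rightarrow> ('m, 'e) tangent \<Rightarrow> real) \<Rightarrow>
     (('m, 'e) vfield \<Rightarrow> ('m, 'e) vfield \<Rightarrow> ('m, 'e) vfield) \<Rightarrow>
     ('m \<Rightarrow> ('m, 'e) tangent \<Rightarrow> ('m, 'e) tangent) \<Rightarrow>
     ('m \<Rightarrow> ('m, 'e) tangent \<Rightarrow> ('m, 'e) tangent) \<Rightarrow>
     ('m \<Rightarrow> ('m, 'e) tangent \<Rightarrow> ('m, 'e) tangent) \<Rightarrow> bool" where
  "hyperkahler_manifold A g nabla I J K \<longleftrightarrow>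
     riemannian_manifold A g \<and> levi_civita A g nabla \<and> (\<exists>m. DIM('e) = 4 * m) \<and>
     endo_field A I \<and> endo_field A J \<and> endo_field A K \<and>
     (\<forall>p. \<forall>v\<in>tangent_space A p.
        I p (I p v) = - v \<and> J p (J p v) = - v \<and> K p (K p v) = - v \<and>
        I p (J p v) = K p v \<and> - J p (I p v) = K p v \<and>
        J p (K p v) = I p v \<and> - K p (J p v) = I p v \<and>
        K p (I p v) = J p v \<and> - I p (K p v) = J p v) \<and>
     (\<forall>R\<in>{I, J, K}. \<forall>p. \<forall>v\<in>tangent_space A p. \<forall>w\<in>tangent_space A p.
        g p (R p v) (R p w) = g p v w) \<and>
     (\<forall>R\<in>{I, J, K}. \<forall>X\<in>vector_fields A. \<forall>Y\<in>vector_fields A.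
        nabla X (endo_apply R Y) - endo_apply R (nabla X Y) = 0)"


section \<open>Riemannian submersions\<close>

definition ker_dist ::
    "('m, 'e::euclidean_space) chart set \<Rightarrow> ('n, 'f::euclidean_space) chart set \<Rightarrow>
     ('m \<Rightarrow> 'n) \<Rightarrow> 'm \<Rightarrow> ('m, 'e) tangent set" where
  "ker_dist A B F p = {v \<in> tangent_space A p. pushforward A B F p v = 0}"

definition orth_dist ::
    "('m, 'e::euclidean_space) chart set \<Rightarrow>
     ('m \<Rightarrow> ('m, 'e) tangent \<Rightarrow> ('m, 'e) tangent \<Rightarrow> real) \<Rightarrow>
     ('m \<Rightarrow> ('m, 'e) tangent set) \<Rightarrow> 'm \<Rightarrow> ('m, 'e) tangent set" where
  "orth_dist A g D p = {v \<in> tangent_space A p. \<forall>w\<in>D p. g p v w = 0}"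

definition riemannian_submersion ::
    "('m::topological_space, 'e::euclidean_space) chart set \<Rightarrow>
     ('m \<Rightarrow> ('m, 'e) tangent \<Rightarrow> ('m, 'e) tangent \<Rightarrow> real) \<Rightarrow>
     ('n::topological_space, 'f::euclidean_space) chart set \<Rightarrow>
     ('n \<Rightarrow> ('n, 'f) tangent \<Rightarrow> ('n, 'f) tangent \<Rightarrow> real) \<Rightarrow> ('m \<Rightarrow> 'n) \<Rightarrow> bool" where
  "riemannian_submersion A g B h F \<longleftrightarrow>
     smooth_map A B F \<and> surj F \<and>
     (\<forall>p. pushforward A B F p ` tangent_space A p = tangent_space B (F p)) \<and>
     (\<forall>p. bij_betw (pushforward A B F p)
            (orth_dist A g (ker_dist A B F) p) (tangent_space B (F p)) \<and>
          (\<forall>v\<in>orth_dist A g (ker_dist A B F) p. \<forall>w\<in>orth_dist A g (ker_dist A B F) p.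
             h (F p) (pushforward A B F p v) (pushforward A B F p w) = g p v w))"

definition h_anti_invariant_submersion ::
    "('m::topological_space, 'e::euclidean_space) chart set \<Rightarrow>
     ('m \<Rightarrow> ('m, 'e) tangent \<Rightarrow> ('m, 'e) tangent \<Rightarrow> real) \<Rightarrow>
     ('m \<Rightarrow> ('m, 'e) tangent \<Rightarrow> ('m, 'e) tangent) \<Rightarrow>
     ('m \<Rightarrow> ('m, 'e) tangent \<Rightarrow> ('m, 'e) tangent) \<Rightarrow>
     ('m \<Rightarrow> ('m, 'e) tangent \<Rightarrow> ('m, 'e) tangent) \<Rightarrow>
     ('n::topological_space, 'f::euclidean_space) chart set \<Rightarrow>
     ('n \<Rightarrow> ('n, 'f) tangent \<Rightarrow> ('n, 'f) tangent \<Rightarrow> real) \<Rightarrow> ('m \<Rightarrow> 'n) \<Rightarrow> bool" where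
  "h_anti_invariant_submersion A g I J K B h F \<longleftrightarrow>
     riemannian_submersion A g B h F \<and>
     (\<forall>R\<in>{I, J, K}. \<forall>p. R p ` ker_dist A B F p \<subseteq> orth_dist A g (ker_dist A B F) p)"

text \<open>In the following, \<open>D\<close> is the vertical distribution \<open>ker F\<^sub>*\<close>. As \<open>g\<close> is positive definite and
  the tangent spaces have finite dimension, the decomposition \<open>U = \<V>U + \<H>U\<close> exists and is unique.\<close>

definition ver ::
    "('m, 'e::euclidean_space) chart set \<Rightarrow>
     ('m \<Rightarrow> ('m, 'e) tangent \<Rightarrow> ('m, 'e) tangent \<Rightarrow> real) \<Rightarrow>
     ('m \<Rightarrow> ('m, 'e) tangent set) \<Rightarrow> ('m, 'e) vfield \<Rightarrow> ('m, 'e) vfield" where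
  "ver A g D U = (\<lambda>p. THE v. v \<in> D p \<and> U p - v \<in> orth_dist A g D p)"

definition hor ::
    "('m, 'e::euclidean_space) chart set \<Rightarrow>
     ('m \<Rightarrow> ('m, 'e) tangent \<Rightarrow> ('m, 'e) tangent \<Rightarrow> real) \<Rightarrow>
     ('m \<Rightarrow> ('m, 'e) tangent set) \<Rightarrow> ('m, 'e) vfield \<Rightarrow> ('m, 'e) vfield" where
  "hor A g D U = U - ver A g D U"

definition oneill_A ::
    "('m, 'e::euclidean_space) chart set \<Rightarrow>
     ('m \<Rightarrow> ('m, 'e) tangent \<Rightarrow> ('m, 'e) tangent \<Rightarrow> real) \<Rightarrow>
     (('m, 'e) vfield \<Rightarrow> ('m, 'e) vfield \<Rightarrow> ('m, 'e) vfield) \<Rightarrow>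
     ('m \<Rightarrow> ('m, 'e) tangent set) \<Rightarrow>
     ('m, 'e) vfield \<Rightarrow> ('m, 'e) vfield \<Rightarrow> ('m, 'e) vfield" where
  "oneill_A A g nabla D U W =
     hor A g D (nabla (hor A g D U) (ver A g D W)) +
     ver A g D (nabla (hor A g D U) (hor A g D W))"

definition B_part ::
    "('m, 'e::euclidean_space) chart set \<Rightarrow>
     ('m \<Rightarrow> ('m, 'e) tangent \<Rightarrow> ('m, 'e) tangent \<Rightarrow> real) \<Rightarrow>
     ('m \<Rightarrow> ('m, 'e) tangent set) \<Rightarrow>
     ('m \<Rightarrow> ('m, 'e) tangent \<Rightarrow> ('m, 'e) tangent) \<Rightarrow> ('m, 'e) vfield \<Rightarrow> ('m, 'e) vfield" where
  "B_part A g D R X = ver A g D (endo_apply R X)"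

definition C_part ::
    "('m, 'e::euclidean_space) chart set \<Rightarrow>
     ('m \<Rightarrow> ('m, 'e) tangent \<Rightarrow> ('m, 'e) tangent \<Rightarrow> real) \<Rightarrow>
     ('m \<Rightarrow> ('m, 'e) tangent set) \<Rightarrow>
     ('m \<Rightarrow> ('m, 'e) tangent \<Rightarrow> ('m, 'e) tangent) \<Rightarrow> ('m, 'e) vfield \<Rightarrow> ('m, 'e) vfield" where
  "C_part A g D R X = hor A g D (endo_apply R X)"

end

theory Submission
  imports Defs
begin

text \<open>Since \<open>R\<close> is a parallel isometry, \<open>g(\<nabla>\<^sub>X Y, V) = g(\<nabla>\<^sub>X RY, RV)\<close>. Splitting \<open>RY = BY + CY\<close>, the
  summand with \<open>BY\<close> is \<open>g(\<A>\<^sub>X BY, RV)\<close> because \<open>RV\<close> is horizontal; \<open>CY\<close> is orthogonal to \<open>R(ker F\<^sub>*)\<close>, so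
  differentiating \<open>g(CY, RV) = 0\<close> turns the other summand into \<open>-g(CY, R \<A>\<^sub>X V)\<close>. Hence each of the
  three conditions says that \<open>g(\<nabla>\<^sub>X Y, V) = 0\<close> for all vertical \<open>V\<close>. Taking \<open>V = \<V>\<nabla>\<^sub>X Y\<close>, this means that
  \<open>\<nabla>\<^sub>X Y\<close> is horizontal. The analytic point is that \<open>\<V>\<close> preserves smoothness: locally, the horizontal
  distribution is spanned by the gradients of the components of \<open>F\<close>, and both these gradients and the
  projection to their span are obtained by Gram-Schmidt orthogonalisation.\<close>

section \<open>Calculus of smooth maps\<close>

lemma Ck_on_subset: "Ck_on k S f \<Longrightarrow> T \<subseteq> S \<Longrightarrow> Ck_on k T f"
  by (induction k arbitrary: f) (auto intro: continuous_on_subset)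

lemma Ck_on_Suc_imp_Ck_on: "Ck_on (Suc k) S f \<Longrightarrow> Ck_on k S f"
proof (induction k arbitrary: f)
  case 0
  then show ?case
    by (auto intro!: continuous_at_imp_continuous_on differentiable_imp_continuous_within)
next
  case (Suc k)
  then show ?case by (metis Ck_on.simps(2))
qed

text \<open>\<open>frechet_derivative\<close> chooses some derivative. Being a derivative at
  \<open>x\<close> is a local property, so the choice is made from the same set for \<open>f\<close>
  and \<open>g\<close>.\<close>

lemma frechet_derivative_cong_open:
  assumes "open S" "x \<in> S" "\<And>x. x \<in> S \<Longrightarrow> f x = g x"
  shows "frechet_derivative f (at x) = frechet_derivative g (at x)"
proof -
  have "(f has_derivative D) (at x) \<longleftrightarrow> (g has_derivative D) (at x)" for D
    using assms by (metis has_derivative_transform_within_open)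
  then show ?thesis
    by (simp add: frechet_derivative_def)
qed

lemma Ck_on_cong:
  assumes "open S"
  shows "(\<And>x. x \<in> S \<Longrightarrow> f x = g x) \<Longrightarrow> Ck_on k S f \<Longrightarrow> Ck_on k S g"
proof (induction k arbitrary: f g)
  case 0
  then show ?case by (simp cong: continuous_on_cong)
next
  case (Suc k)
  have "g differentiable (at x)" if "x \<in> S" for x
    using Suc.prems that assms unfolding differentiable_def Ck_on.simps
    by (metis has_derivative_transform_within_open)
  moreover have "Ck_on k S (\<lambda>x. frechet_derivative g (at x) v)" for v
  proof (rule Suc.IH)
    show "Ck_on k S (\<lambda>x. frechet_derivative f (at x) v)"
      using Suc.prems by simp
    show "frechet_derivative f (at x) v = frechet_derivative g (at x) v" if "x \<in> S" for x
      using frechet_derivative_cong_open[OF assms that Suc.prems(1)] by simp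
  qed
  ultimately show ?case by simp
qed

text \<open>The differentiability clauses are pointwise; openness of the pieces enters in the base
  case, where continuity is glued.\<close>

lemma Ck_on_UN:
  assumes "\<And>i. i \<in> I \<Longrightarrow> open (S i)"
  shows "(\<And>i. i \<in> I \<Longrightarrow> Ck_on k (S i) f) \<Longrightarrow> Ck_on k (\<Union>i\<in>I. S i) f"
  using assms by (induction k arbitrary: f) (auto intro: continuous_on_open_UN)

lemma Ck_on_const: "Ck_on k S (\<lambda>x. c)"
  by (induction k arbitrary: c) (auto simp: frechet_derivative_const)

text \<open>Uniqueness of derivatives allows an explicit formula in place of
  \<open>frechet_derivative\<close>. The induction steps for sums, products and inverses below use
  this form.\<close>

lemma Ck_on_SucI:
  assumes "open S" "\<And>x. x \<in> S \<Longrightarrow> (f has_derivative f' x) (at x)"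
    and "\<And>v. Ck_on k S (\<lambda>x. f' x v)"
  shows "Ck_on (Suc k) S f"
proof -
  have "frechet_derivative f (at x) = f' x" if "x \<in> S" for x
    using assms(2)[OF that] frechet_derivative_at by metis
  then have "Ck_on k S (\<lambda>x. frechet_derivative f (at x) v)" for v
    by (intro Ck_on_cong[OF assms(1) _ assms(3)[of v]]) simp
  then show ?thesis
    using assms(2) by (auto simp: differentiable_def)
qed

lemma Ck_on_Suc_has_derivative:
  "Ck_on (Suc k) S f \<Longrightarrow> x \<in> S \<Longrightarrow> (f has_derivative frechet_derivative f (at x)) (at x)"
  by (simp add: frechet_derivative_works)

lemma Ck_on_add:
  assumes "open S"
  shows "Ck_on k S f \<Longrightarrow> Ck_on k S g \<Longrightarrow> Ck_on k S (\<lambda>x. f x + g x)"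
proof (induction k arbitrary: f g)
  case 0
  then show ?case by (simp add: continuous_on_add)
next
  case (Suc k)
  show ?case
  proof (rule Ck_on_SucI[OF assms])
    fix x assume "x \<in> S"
    show "((\<lambda>x. f x + g x) has_derivative
        (\<lambda>v. frechet_derivative f (at x) v + frechet_derivative g (at x) v)) (at x)"
      using Suc.prems[THEN Ck_on_Suc_has_derivative, OF \<open>x \<in> S\<close>] by (rule has_derivative_add)
  next
    show "Ck_on k S (\<lambda>x. frechet_derivative f (at x) v + frechet_derivative g (at x) v)" for v
      using Suc by simp
  qed
qed

text \<open>By the Leibniz rule the derivative is a sum of two terms of the same shape, each with
  one factor differentiated. Hence the induction generalises over \<open>f\<close> and
  \<open>g\<close>, and the undifferentiated factor is lowered from order \<open>Suc k\<close> to
  \<open>k\<close>.\<close>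

lemma Ck_on_bilinear:
  assumes "bounded_bilinear h" "open S"
  shows "Ck_on k S f \<Longrightarrow> Ck_on k S g \<Longrightarrow> Ck_on k S (\<lambda>x. h (f x) (g x))"
proof (induction k arbitrary: f g)
  case 0
  then show ?case by (simp add: bounded_bilinear.continuous_on[OF assms(1)])
next
  case (Suc k)
  show ?case
  proof (rule Ck_on_SucI[OF assms(2)])
    fix x assume "x \<in> S"
    show "((\<lambda>x. h (f x) (g x)) has_derivative
        (\<lambda>v. h (f x) (frechet_derivative g (at x) v) + h (frechet_derivative f (at x) v) (g x))) (at x)"
      using Suc.prems[THEN Ck_on_Suc_has_derivative, OF \<open>x \<in> S\<close>]
      by (rule bounded_bilinear.FDERIV[OF assms(1)])
  next
    have "Ck_on k S f" "Ck_on k S g"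
      using Suc.prems Ck_on_Suc_imp_Ck_on by blast+
    then show "Ck_on k S (\<lambda>x. h (f x) (frechet_derivative g (at x) v) + h (frechet_derivative f (at x) v) (g x))" for v
      using Suc by (intro Ck_on_add assms(2) Suc.IH) auto
  qed
qed

text \<open>The derivative of \<open>1/f\<close> is \<open>-(1/f) f' (1/f)\<close>, a product of
  \<open>f'\<close> with factors covered by the induction hypothesis.\<close>

lemma Ck_on_inverse:
  fixes f :: "'a::real_normed_vector \<Rightarrow> 'b::real_normed_field"
  assumes "open S" "\<And>x. x \<in> S \<Longrightarrow> f x \<noteq> 0"
  shows "Ck_on k S f \<Longrightarrow> Ck_on k S (\<lambda>x. inverse (f x))"
proof (induction k)
  case 0
  then show ?case using assms by (simp add: continuous_on_inverse)
next
  case (Suc k)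
  show ?case
  proof (rule Ck_on_SucI[OF assms(1)])
    fix x assume "x \<in> S"
    show "((\<lambda>x. inverse (f x)) has_derivative
        (\<lambda>v. (-1) * ((inverse (f x) * frechet_derivative f (at x) v) * inverse (f x)))) (at x)"
      using Deriv.has_derivative_inverse[OF assms(2)[OF \<open>x \<in> S\<close>] Ck_on_Suc_has_derivative[OF Suc.prems \<open>x \<in> S\<close>]]
      by simp
  next
    have "Ck_on k S (\<lambda>x. inverse (f x))"
      using Suc Ck_on_Suc_imp_Ck_on by blast
    then show "Ck_on k S (\<lambda>x. (-1) * ((inverse (f x) * frechet_derivative f (at x) v) * inverse (f x)))" for v
      using Suc.prems by (intro Ck_on_bilinear[OF bounded_bilinear_mult assms(1)] Ck_on_const) auto
  qed
qed

section \<open>Passage from finite order of differentiability to smooth maps\<close>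

lemma smooth_on_subset: "smooth_on S f \<Longrightarrow> T \<subseteq> S \<Longrightarrow> smooth_on T f"
  by (auto simp: smooth_on_def intro: Ck_on_subset)

lemma smooth_on_cong: "open S \<Longrightarrow> (\<And>x. x \<in> S \<Longrightarrow> f x = g x) \<Longrightarrow> smooth_on S f \<Longrightarrow> smooth_on S g"
  by (auto simp: smooth_on_def intro: Ck_on_cong)

lemma smooth_on_locally:
  assumes "\<And>x. x \<in> S \<Longrightarrow> \<exists>T. open T \<and> x \<in> T \<and> smooth_on T f"
  shows "smooth_on S f"
proof -
  obtain T where T: "\<And>x. x \<in> S \<Longrightarrow> open (T x) \<and> x \<in> T x \<and> smooth_on (T x) f"
    using assms by metis
  then have "smooth_on (\<Union>x\<in>S. T x) f"
    by (auto simp: smooth_on_def intro!: Ck_on_UN)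
  then show ?thesis
    by (rule smooth_on_subset) (use T in blast)
qed

lemma smooth_on_const: "smooth_on S (\<lambda>x. c)"
  by (simp add: smooth_on_def Ck_on_const)

lemma smooth_on_add:
  "open S \<Longrightarrow> smooth_on S f \<Longrightarrow> smooth_on S g \<Longrightarrow> smooth_on S (\<lambda>x. f x + g x)"
  by (simp add: smooth_on_def Ck_on_add)

lemma smooth_on_scaleR:
  "open S \<Longrightarrow> smooth_on S f \<Longrightarrow> smooth_on S g \<Longrightarrow> smooth_on S (\<lambda>x. f x *\<^sub>R g x)"
  by (simp add: smooth_on_def Ck_on_bilinear[OF bounded_bilinear_scaleR])

lemma smooth_on_inner:
  "open S \<Longrightarrow> smooth_on S f \<Longrightarrow> smooth_on S g \<Longrightarrow> smooth_on S (\<lambda>x. f x \<bullet> g x)"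
  by (simp add: smooth_on_def Ck_on_bilinear[OF bounded_bilinear_inner])

lemma smooth_on_diff:
  "open S \<Longrightarrow> smooth_on S f \<Longrightarrow> smooth_on S g \<Longrightarrow> smooth_on S (\<lambda>x. f x - g x)"
  using smooth_on_add[of S f "\<lambda>x. (-1) *\<^sub>R g x"] smooth_on_scaleR[of S "\<lambda>x. -1" g]
  by (simp add: smooth_on_const)

lemma smooth_on_divide:
  fixes f g :: "'a::real_normed_vector \<Rightarrow> real"
  assumes "open S" "smooth_on S f" "smooth_on S g" "\<And>x. x \<in> S \<Longrightarrow> g x \<noteq> 0"
  shows "smooth_on S (\<lambda>x. f x / g x)"
  unfolding smooth_on_def divide_inverse using assms
  by (auto simp: smooth_on_def intro!: Ck_on_bilinear[OF bounded_bilinear_mult] Ck_on_inverse)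

lemma smooth_on_sum:
  assumes "open S" "\<And>i. i \<in> I \<Longrightarrow> smooth_on S (f i)"
  shows "smooth_on S (\<lambda>x. \<Sum>i\<in>I. f i x)"
  using assms(2) by (induction I rule: infinite_finite_induct)
    (auto simp: smooth_on_const intro!: smooth_on_add assms(1))

lemma smooth_on_frechet_derivative:
  "smooth_on S f \<Longrightarrow> smooth_on S (\<lambda>x. frechet_derivative f (at x) v)"
  by (metis Ck_on.simps(2) smooth_on_def)

lemma smooth_on_has_derivative:
  "smooth_on S f \<Longrightarrow> x \<in> S \<Longrightarrow> (f has_derivative frechet_derivative f (at x)) (at x)"
  using Ck_on_Suc_has_derivative smooth_on_def by blast

text \<open>Expanding \<open>f x\<close> in the standard basis leaves a finite sum of products of
  smooth functions. This extends smoothness from constant arguments to smoothly varying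
  ones.\<close>

lemma smooth_on_linear_apply:
  fixes f :: "'a::real_normed_vector \<Rightarrow> 'b::euclidean_space"
    and l :: "'a \<Rightarrow> 'b \<Rightarrow> 'c::real_normed_vector"
  assumes "open S" "\<And>x. x \<in> S \<Longrightarrow> linear (l x)" "\<And>u. smooth_on S (\<lambda>x. l x u)" "smooth_on S f"
  shows "smooth_on S (\<lambda>x. l x (f x))"
proof (rule smooth_on_cong[OF assms(1)])
  show "smooth_on S (\<lambda>x. \<Sum>b\<in>Basis. (f x \<bullet> b) *\<^sub>R l x b)"
    by (intro smooth_on_sum smooth_on_scaleR smooth_on_inner smooth_on_const assms)
  fix x assume "x \<in> S"
  then have "l x (\<Sum>b\<in>Basis. (f x \<bullet> b) *\<^sub>R b) = (\<Sum>b\<in>Basis. (f x \<bullet> b) *\<^sub>R l x b)"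
    using assms(2) by (simp add: linear_sum linear_scale)
  then show "(\<Sum>b\<in>Basis. (f x \<bullet> b) *\<^sub>R l x b) = l x (f x)"
    by (simp add: euclidean_representation)
qed

section \<open>Smooth orthogonal projections in Euclidean space\<close>

text \<open>A Riemannian metric read in one chart: a smooth family of inner products on the model
  space, so that orthogonalisation can be done without tangent vectors.\<close>

locale smooth_inner_products =
  fixes S :: "'e::euclidean_space set" and G :: "'e \<Rightarrow> 'e \<Rightarrow> 'e \<Rightarrow> real"
  assumes open_S: "open S"
    and linear_left: "x \<in> S \<Longrightarrow> linear (\<lambda>u. G x u w)"
    and commute: "x \<in> S \<Longrightarrow> G x u w = G x w u"
    and pos: "x \<in> S \<Longrightarrow> u \<noteq> 0 \<Longrightarrow> G x u u > 0"
    and smooth: "smooth_on S (\<lambda>x. G x u w)"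
begin

lemma G_left:
  assumes "x \<in> S"
  shows "G x (u + v) w = G x u w + G x v w" "G x (u - v) w = G x u w - G x v w"
    "G x (r *\<^sub>R u) w = r * G x u w" "G x 0 w = 0"
  using linear_add[OF linear_left[OF assms]] linear_diff[OF linear_left[OF assms]]
    linear_scale[OF linear_left[OF assms]] linear_0[OF linear_left[OF assms]] by simp_all

lemma linear_right: "x \<in> S \<Longrightarrow> linear (G x u)"
  by (simp add: linear_iff G_left commute[of x u])

text \<open>\<open>smooth_on_linear_apply\<close>, once for each argument.\<close>

lemma smooth_on_G:
  assumes "smooth_on S U" "smooth_on S W"
  shows "smooth_on S (\<lambda>x. G x (U x) (W x))"
proof (rule smooth_on_linear_apply[OF open_S linear_right _ assms(2)])
  show "smooth_on S (\<lambda>x. G x (U x) w)" for w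
    by (rule smooth_on_linear_apply[OF open_S linear_left smooth assms(1)])
qed

text \<open>Gram-Schmidt: the functional is corrected along the component \<open>n\<close> of the new field that is
  orthogonal to the previous ones. Representing the functionals \<open>G x (U x)\<close> gives projections.\<close>

lemma smooth_representation:
  fixes s :: "'i \<Rightarrow> 'e \<Rightarrow> 'e" and l :: "'e \<Rightarrow> 'e \<Rightarrow> real"
  assumes "finite A" "\<And>i. i \<in> A \<Longrightarrow> smooth_on S (s i)"
    and "\<And>x i. x \<in> S \<Longrightarrow> i \<in> A \<Longrightarrow> s i x \<notin> span ((\<lambda>j. s j x) ` (A - {i}))"
    and "\<And>x. x \<in> S \<Longrightarrow> linear (l x)" "\<And>u. smooth_on S (\<lambda>x. l x u)"
  shows "\<exists>N. smooth_on S N \<and> (\<forall>x\<in>S. N x \<in> span ((\<lambda>i. s i x) ` A) \<and>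
           (\<forall>i\<in>A. G x (N x) (s i x) = l x (s i x)))"
  using assms
proof (induction A arbitrary: l rule: finite_induct)
  case empty
  show ?case
    by (intro exI[of _ "\<lambda>x. 0"]) (simp add: smooth_on_const)
next
  case (insert a A)
  let ?span = "\<lambda>x. span ((\<lambda>i. s i x) ` A)"
  have indep: "s i x \<notin> span ((\<lambda>j. s j x) ` (A - {i}))" if "x \<in> S" "i \<in> A" for x i
    using insert.prems(2)[of x i] that span_mono[of "(\<lambda>j. s j x) ` (A - {i})" "(\<lambda>j. s j x) ` (insert a A - {i})"]
    by auto
  have sm: "smooth_on S (s i)" if "i \<in> insert a A" for i
    using insert.prems(1) that by blast
  obtain N where N: "smooth_on S N" "\<And>x. x \<in> S \<Longrightarrow> N x \<in> ?span x"
      "\<And>x i. x \<in> S \<Longrightarrow> i \<in> A \<Longrightarrow> G x (N x) (s i x) = l x (s i x)"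
    using insert.IH[OF sm indep insert.prems(3,4)] by auto
  \<comment> \<open>The induction hypothesis holds for every functional. With the functional
    \<open>G x (s a x)\<close> it yields the orthogonal projection \<open>P\<close> of the new field
    to the span of the previous ones.\<close>
  obtain P where P: "smooth_on S P" "\<And>x. x \<in> S \<Longrightarrow> P x \<in> ?span x"
      "\<And>x i. x \<in> S \<Longrightarrow> i \<in> A \<Longrightarrow> G x (P x) (s i x) = G x (s a x) (s i x)"
    using insert.IH[OF sm indep linear_right smooth_on_G[OF sm[OF insertI1] smooth_on_const]] by auto
  define n where "n = (\<lambda>x. s a x - P x)"
  have n: "smooth_on S n"
    unfolding n_def using sm P(1) by (intro smooth_on_diff open_S) auto
  have n_pos: "G x (n x) (n x) > 0" if "x \<in> S" for x
  proof -
    have "A - {a} = A" using insert.hyps by blast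
    then have "s a x \<notin> ?span x"
      using insert.prems(2)[OF that, of a] by (simp add: insert_Diff_if)
    then have "n x \<noteq> 0" using P(2)[OF that] by (auto simp: n_def)
    then show ?thesis using pos that by blast
  qed
  have n_orth: "G x (n x) (s i x) = 0" if "x \<in> S" "i \<in> A" for x i
    using G_left[OF that(1)] P(3)[OF that] by (simp add: n_def)
  have n_orth_span: "G x (n x) w = 0" if "x \<in> S" "w \<in> ?span x" for x w
  proof -
    have "subspace {w. G x (n x) w = 0}"
      using linear_right[OF that(1)] by (simp add: subspace_def linear_add linear_scale linear_0)
    then have "?span x \<subseteq> {w. G x (n x) w = 0}"
      using n_orth that(1) by (intro span_minimal) auto
    then show ?thesis using that by blast
  qed
  \<comment> \<open>The coefficient solves
    \<open>G x (N x + r x *\<^sub>R n x) (n x) = l x (n x)\<close>. The added multiple of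
    \<open>n\<close> does not disturb the values on the previous fields, to which \<open>n\<close>
    is orthogonal.\<close>
  define r where "r = (\<lambda>x. (l x (n x) - G x (N x) (n x)) / G x (n x) (n x))"
  have r: "smooth_on S r"
    unfolding r_def
    using n_pos by (intro smooth_on_divide smooth_on_diff smooth_on_G n N(1) open_S
        smooth_on_linear_apply[OF _ insert.prems(3,4)]) force+
  have "smooth_on S (\<lambda>x. N x + r x *\<^sub>R n x)"
    by (intro smooth_on_add smooth_on_scaleR open_S n N(1) r)
  moreover have "N x + r x *\<^sub>R n x \<in> span ((\<lambda>i. s i x) ` insert a A)" if "x \<in> S" for x
  proof -
    have "?span x \<subseteq> span ((\<lambda>i. s i x) ` insert a A)"
      by (intro span_mono) auto
    then show ?thesis
      using N(2)[OF that] P(2)[OF that] unfolding n_def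
      by (intro span_add span_scale span_diff) (auto intro: span_base)
  qed
  moreover have "G x (N x + r x *\<^sub>R n x) (s i x) = l x (s i x)" if x: "x \<in> S" and i: "i \<in> insert a A" for x i
  proof (cases "i = a")
    case True
    \<comment> \<open>On the summand \<open>P x\<close>, which lies in the old span,
      \<open>N\<close> already represents \<open>l\<close> and \<open>n\<close> contributes nothing;
      on \<open>n x\<close> the choice of \<open>r\<close> gives the value.\<close>
    have sa: "s a x = n x + P x" by (simp add: n_def)
    have "subspace {w. G x (N x) w = l x w}"
      using linear_right[OF x] insert.prems(3)[OF x]
      by (simp add: subspace_def linear_add linear_scale linear_0)
    then have "?span x \<subseteq> {w. G x (N x) w = l x w}"
      using N(3)[OF x] by (intro span_minimal) auto
    then have "G x (N x) (P x) = l x (P x)" using P(2)[OF x] by blast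
    moreover have "G x (n x) (P x) = 0" using n_orth_span P(2) x by blast
    moreover have "r x * G x (n x) (n x) = l x (n x) - G x (N x) (n x)"
      using n_pos[OF x] by (simp add: r_def)
    ultimately have "G x (N x + r x *\<^sub>R n x) (n x + P x) = l x (n x + P x)"
      using G_left[OF x] linear_right[OF x] insert.prems(3)[OF x]
      by (simp add: linear_add linear_scale)
    then show ?thesis using True sa by simp
  next
    case False
    then show ?thesis
      using i N(3)[OF x] n_orth[OF x] G_left[OF x] by simp
  qed
  ultimately show ?case by blast
qed

text \<open>The horizontal part is the projection to the span of the gradients of the components of
  \<open>\<phi>\<close>, which are linearly independent because \<open>\<phi>\<close> is a submersion.\<close>

lemma smooth_horizontal_part:
  fixes \<phi> :: "'e \<Rightarrow> 'f::euclidean_space"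
  assumes \<phi>: "smooth_on S \<phi>" and surj: "\<And>x. x \<in> S \<Longrightarrow> surj (frechet_derivative \<phi> (at x))"
    and U: "smooth_on S U"
  shows "\<exists>W. smooth_on S W \<and> (\<forall>x\<in>S. frechet_derivative \<phi> (at x) (U x - W x) = 0 \<and>
           (\<forall>w. frechet_derivative \<phi> (at x) w = 0 \<longrightarrow> G x (W x) w = 0))"
proof -
  let ?D = "\<lambda>x. frechet_derivative \<phi> (at x)"
  have lin: "linear (?D x)" if "x \<in> S" for x
    using smooth_on_has_derivative[OF \<phi> that] has_derivative_linear by blast
  \<comment> \<open>The functional \<open>\<lambda>u. ?D x u \<bullet> b\<close> is represented
    against the constant fields of the standard basis.\<close>
  have "\<exists>N. smooth_on S N \<and> (\<forall>x\<in>S. \<forall>i\<in>Basis. G x (N x) i = ?D x i \<bullet> b)" for b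
  proof -
    have "linear (\<lambda>u. ?D x u \<bullet> b)" if "x \<in> S" for x
      using lin[OF that] by (simp add: linear_iff inner_add_left)
    moreover have "smooth_on S (\<lambda>x. ?D x u \<bullet> b)" for u
      by (intro smooth_on_inner smooth_on_frechet_derivative \<phi> open_S smooth_on_const)
    moreover have "i \<notin> span ((\<lambda>j. j) ` (Basis - {i}))" if "i \<in> Basis" for i :: 'e
      using independent_Basis[where 'a='e] that by (auto simp: dependent_def)
    ultimately show ?thesis
      using smooth_representation[of Basis "\<lambda>i x. i" "\<lambda>x u. ?D x u \<bullet> b"] smooth_on_const by fastforce
  qed
  then obtain N where N: "\<And>b. smooth_on S (N b)"
      and NB: "\<And>b x i. x \<in> S \<Longrightarrow> i \<in> Basis \<Longrightarrow> G x (N b x) i = ?D x i \<bullet> b"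
    by metis
  \<comment> \<open>Linear functionals that agree on \<open>Basis\<close> are equal, so
    \<open>N b\<close> is the \<open>G\<close>-gradient of the component \<open>b\<close> of
    \<open>\<phi>\<close>.\<close>
  have grad: "G x (N b x) u = ?D x u \<bullet> b" if "x \<in> S" for b x u
  proof (rule linear_eq_stdbasis[of "G x (N b x)" "\<lambda>u. ?D x u \<bullet> b", THEN fun_cong])
    show "linear (\<lambda>u. ?D x u \<bullet> b)"
      using lin[OF that] by (simp add: linear_iff inner_add_left)
  qed (use that NB linear_right in auto)
  \<comment> \<open>Used twice: with \<open>Basis - {b}\<close> for the independence of the
    gradients, and with \<open>Basis\<close> to show that their span is orthogonal to the
    kernel.\<close>
  have orth: "G x w u = 0" if "x \<in> S" "w \<in> span ((\<lambda>b. N b x) ` A)" "\<And>b. b \<in> A \<Longrightarrow> ?D x u \<bullet> b = 0"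
    for x w u A
  proof -
    have "subspace {w. G x w u = 0}"
      using G_left[OF that(1)] by (simp add: subspace_def)
    then have "span ((\<lambda>b. N b x) ` A) \<subseteq> {w. G x w u = 0}"
      using that grad by (intro span_minimal) auto
    then show ?thesis using that by blast
  qed
  have "N b x \<notin> span ((\<lambda>b. N b x) ` (Basis - {b}))" if x: "x \<in> S" and b: "b \<in> Basis" for x b
  proof
    assume "N b x \<in> span ((\<lambda>b. N b x) ` (Basis - {b}))"
    \<comment> \<open>A preimage \<open>u\<close> of \<open>b\<close> has no component along the
      other basis vectors, so \<open>orth\<close> makes its pairing with \<open>N b x\<close> zero,
      whereas \<open>grad\<close> makes that pairing \<open>b \<bullet> b\<close>.\<close>
    moreover obtain u where u: "?D x u = b"
      using surj[OF x] by (metis surjD)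
    ultimately have "G x (N b x) u = 0"
      using orth[OF x] b by (force simp: inner_Basis)
    then show False
      using grad[OF x] u b by simp
  qed
  \<comment> \<open>\<open>W\<close> is the orthogonal projection of \<open>U\<close> to the span of
    the gradients: it represents the functional \<open>G x (U x)\<close> there.\<close>
  then obtain W where W: "smooth_on S W"
      "\<And>x. x \<in> S \<Longrightarrow> W x \<in> span ((\<lambda>b. N b x) ` Basis)"
      "\<And>x b. x \<in> S \<Longrightarrow> b \<in> Basis \<Longrightarrow> G x (W x) (N b x) = G x (U x) (N b x)"
    using smooth_representation[where A = Basis and s = N and l = "\<lambda>x. G x (U x)",
        OF finite_Basis N _ linear_right smooth_on_G[OF U smooth_on_const]] by auto
  \<comment> \<open>Each component of this derivative is a pairing of \<open>U x - W x\<close> with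
    a gradient, which vanishes by the choice of \<open>W\<close>.\<close>
  have "?D x (U x - W x) = 0" if x: "x \<in> S" for x
  proof (rule euclidean_eqI)
    fix b :: 'f assume "b \<in> Basis"
    then have "G x (U x - W x) (N b x) = 0"
      using W(3)[OF x] G_left[OF x] by simp
    then show "?D x (U x - W x) \<bullet> b = 0 \<bullet> b"
      using grad[OF x] commute[OF x] by simp
  qed
  moreover have "G x (W x) w = 0" if "x \<in> S" "?D x w = 0" for x w
    using orth[OF that(1) W(2)] that by auto
  ultimately show ?thesis using W(1) by blast
qed

end

section \<open>Tangent spaces and metrics in charts\<close>

locale smooth_manifold =
  fixes A :: "('m::topological_space, 'e::euclidean_space) chart set"
  assumes atlas: "smooth_atlas A"
begin

lemma chart_exists: "\<exists>c\<in>A. p \<in> fst c"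
  using atlas unfolding smooth_atlas_def by blast

lemma chart_at: "chart_at A p \<in> A" "p \<in> fst (chart_at A p)"
  unfolding chart_at_def using someI_ex[of "\<lambda>c. c \<in> A \<and> p \<in> fst c"] chart_exists by blast+

lemma chart_homeomorphism:
  "c \<in> A \<Longrightarrow> homeomorphism (fst c) (snd c ` fst c) (snd c) (chart_inv c)"
  using atlas by (simp add: smooth_atlas_def)

lemma chart_inv [simp]: "c \<in> A \<Longrightarrow> p \<in> fst c \<Longrightarrow> chart_inv c (snd c p) = p"
  using chart_homeomorphism by (simp add: homeomorphism_def)

lemma open_chart_image:
  assumes "c \<in> A" "open W"
  shows "open (snd c ` (fst c \<inter> W))"
proof -
  have "openin (top_of_set (snd c ` fst c)) (snd c ` (fst c \<inter> W))"
    using homeomorphism_imp_open_map[OF chart_homeomorphism[OF assms(1)]] assms(2)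
    by (simp add: openin_open_Int)
  moreover have "open (snd c ` fst c)"
    using atlas assms(1) by (simp add: smooth_atlas_def)
  ultimately show ?thesis by (simp add: openin_open_eq)
qed

lemma open_chart_domain: "c \<in> A \<Longrightarrow> open (fst c)"
  using atlas by (simp add: smooth_atlas_def)

lemma transition_has_derivative:
  assumes "c \<in> A" "d \<in> A" "p \<in> fst c" "p \<in> fst d"
  shows "((snd d \<circ> chart_inv c) has_derivative
     frechet_derivative (snd d \<circ> chart_inv c) (at (snd c p))) (at (snd c p))"
  using assms atlas
  by (intro smooth_on_has_derivative[of "snd c ` (fst c \<inter> fst d)"]) (auto simp: smooth_atlas_def)

text \<open>Near the point, \<open>f \<circ> chart_inv c\<close> factors through the transition map
  to \<open>d\<close>, and the chain rule applies. All independence of charts below rests on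
  this.\<close>

lemma has_derivative_change_chart:
  assumes cd: "c \<in> A" "d \<in> A" "p \<in> fst c" "p \<in> fst d"
    and f: "((f \<circ> chart_inv d) has_derivative L) (at (snd d p))"
  shows "((f \<circ> chart_inv c) has_derivative
     L \<circ> frechet_derivative (snd d \<circ> chart_inv c) (at (snd c p))) (at (snd c p))"
proof (rule has_derivative_transform_within_open)
  show "((f \<circ> chart_inv d) \<circ> (snd d \<circ> chart_inv c) has_derivative
     L \<circ> frechet_derivative (snd d \<circ> chart_inv c) (at (snd c p))) (at (snd c p))"
    using diff_chain_at[OF transition_has_derivative[OF cd]] f cd by simp
  show "open (snd c ` (fst c \<inter> fst d))"
    using cd by (intro open_chart_image open_chart_domain)
qed (use cd in auto)

section \<open>Tangent vectors and their coordinates\<close>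

lemma tangent_change_chart:
  assumes "v \<in> tangent_space A p" "c \<in> A" "d \<in> A" "p \<in> fst c" "p \<in> fst d"
  shows "frechet_derivative (snd d \<circ> chart_inv c) (at (snd c p)) (v c) = v d"
  by (rule assms(1)[unfolded tangent_space_def mem_Collect_eq, THEN conjunct1, rule_format,
        OF assms(2-5), symmetric])

lemma tangent_outside: "v \<in> tangent_space A p \<Longrightarrow> \<not> (c \<in> A \<and> p \<in> fst c) \<Longrightarrow> v c = 0"
  by (cases c) (simp add: tangent_space_def)

lemma tangent_spaceI:
  assumes "\<And>c d. c \<in> A \<Longrightarrow> d \<in> A \<Longrightarrow> p \<in> fst c \<Longrightarrow> p \<in> fst d \<Longrightarrow>
      frechet_derivative (snd d \<circ> chart_inv c) (at (snd c p)) (v c) = v d"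
    and "\<And>c. \<not> (c \<in> A \<and> p \<in> fst c) \<Longrightarrow> v c = 0"
  shows "v \<in> tangent_space A p"
  unfolding tangent_space_def
  by (intro CollectI conjI ballI allI impI) ((rule assms(1)[symmetric]; assumption), rule assms(2), blast)

lemma linear_transition:
  assumes "c \<in> A" "d \<in> A" "p \<in> fst c" "p \<in> fst d"
  shows "linear (frechet_derivative (snd d \<circ> chart_inv c) (at (snd c p)))"
  using transition_has_derivative[OF assms] has_derivative_linear by blast

lemma subspace_tangent_space: "subspace (tangent_space A p)"
proof (rule subspaceI)
  show "0 \<in> tangent_space A p"
    by (rule tangent_spaceI) (simp_all add: linear_0[OF linear_transition])
  fix v assume v: "v \<in> tangent_space A p"
  { fix u assume u: "u \<in> tangent_space A p"
    show "v + u \<in> tangent_space A p"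
    proof (rule tangent_spaceI)
      fix c d assume "c \<in> A" "d \<in> A" "p \<in> fst c" "p \<in> fst d"
      note cd = this
      show "frechet_derivative (snd d \<circ> chart_inv c) (at (snd c p)) ((v + u) c) = (v + u) d"
        by (simp only: plus_fun_apply linear_add[OF linear_transition[OF cd]]
            tangent_change_chart[OF v cd] tangent_change_chart[OF u cd])
    qed (simp add: tangent_outside[OF v] tangent_outside[OF u]) }
  show "a *\<^sub>R v \<in> tangent_space A p" for a
  proof (rule tangent_spaceI)
    fix c d assume "c \<in> A" "d \<in> A" "p \<in> fst c" "p \<in> fst d"
    note cd = this
    show "frechet_derivative (snd d \<circ> chart_inv c) (at (snd c p)) ((a *\<^sub>R v) c) = (a *\<^sub>R v) d"
      by (simp only: scaleR_fun_def linear_scale[OF linear_transition[OF cd]] tangent_change_chart[OF v cd])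
  qed (simp add: scaleR_fun_def tangent_outside[OF v])
qed

text \<open>The compatibility condition is the cocycle rule for derivatives of transition maps: from
  \<open>c\<close> to \<open>d\<close> and then to \<open>e\<close> is the same as from
  \<open>c\<close> to \<open>e\<close>.\<close>

lemma coord_vector_in_tangent_space:
  assumes "c \<in> A" "p \<in> fst c"
  shows "coord_vector A c u p \<in> tangent_space A p"
proof -
  have "frechet_derivative (snd e \<circ> chart_inv d) (at (snd d p))
        (frechet_derivative (snd d \<circ> chart_inv c) (at (snd c p)) u) =
      frechet_derivative (snd e \<circ> chart_inv c) (at (snd c p)) u"
    if "d \<in> A" "e \<in> A" "p \<in> fst d" "p \<in> fst e" for d e
    using has_derivative_change_chart[OF assms(1) that(1) assms(2) that(3)
        transition_has_derivative[OF that], THEN frechet_derivative_at, THEN fun_cong, of u] by simp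
  then show ?thesis
    using assms by (intro tangent_spaceI) (auto simp: coord_vector_def)
qed

lemma coord_vector_self:
  assumes "c \<in> A" "p \<in> fst c"
  shows "coord_vector A c u p c = u"
proof -
  have "((snd c \<circ> chart_inv c) has_derivative (\<lambda>u. u)) (at (snd c p))"
    by (rule has_derivative_transform_within_open[OF has_derivative_ident,
          of "snd c ` (fst c \<inter> UNIV)"]) (use assms open_chart_image[OF assms(1) open_UNIV] in auto)
  then show ?thesis
    using frechet_derivative_at assms by (metis coord_vector_def)
qed

text \<open>Together with \<open>coord_vector_self\<close> this identifies the tangent space at
  \<open>p\<close> with the model space, by evaluation at \<open>c\<close>.\<close>

lemma coord_vector_tangent:
  assumes "v \<in> tangent_space A p" "c \<in> A" "p \<in> fst c"
  shows "coord_vector A c (v c) p = v"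
proof
  show "coord_vector A c (v c) p d = v d" for d
    using assms by (auto simp: coord_vector_def tangent_change_chart tangent_outside)
qed

lemma linear_coord_vector:
  assumes "c \<in> A" "p \<in> fst c"
  shows "linear (\<lambda>u. coord_vector A c u p)"
  using assms
  by (intro linearI ext)
    (simp_all add: coord_vector_def scaleR_fun_def linear_add[OF linear_transition] linear_scale[OF linear_transition])

lemma coord_vector_add:
  "c \<in> A \<Longrightarrow> p \<in> fst c \<Longrightarrow> coord_vector A c (u + w) p = coord_vector A c u p + coord_vector A c w p"
  by (rule linear_add[OF linear_coord_vector])

lemma coord_vector_scale:
  "c \<in> A \<Longrightarrow> p \<in> fst c \<Longrightarrow> coord_vector A c (r *\<^sub>R u) p = r *\<^sub>R coord_vector A c u p"
  by (rule linear_scale[OF linear_coord_vector])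

section \<open>Smooth vector fields and endomorphism fields\<close>

lemma vector_field_tangent: "X \<in> vector_fields A \<Longrightarrow> X p \<in> tangent_space A p"
  by (simp add: vector_fields_def)

lemma open_chart_codomain: "c \<in> A \<Longrightarrow> open (snd c ` fst c)"
  using atlas by (simp add: smooth_atlas_def)

lemma vector_fields_diff: "X \<in> vector_fields A \<Longrightarrow> Y \<in> vector_fields A \<Longrightarrow> X - Y \<in> vector_fields A"
  unfolding vector_fields_def
  by (simp add: subspace_diff[OF subspace_tangent_space] smooth_on_diff[OF open_chart_codomain])

lemma vector_fields_zero: "0 \<in> vector_fields A"
  by (simp add: vector_fields_def subspace_0[OF subspace_tangent_space] smooth_on_const)

lemma endo_field_linear:
  assumes "endo_field A R" "v \<in> tangent_space A p" "w \<in> tangent_space A p"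
  shows "R p (a *\<^sub>R v + b *\<^sub>R w) = a *\<^sub>R R p v + b *\<^sub>R R p w"
  using assms by (simp add: endo_field_def)

lemma endo_field_tangent:
  "endo_field A R \<Longrightarrow> v \<in> tangent_space A p \<Longrightarrow> R p v \<in> tangent_space A p"
  by (simp add: endo_field_def)

lemma endo_field_add:
  "endo_field A R \<Longrightarrow> v \<in> tangent_space A p \<Longrightarrow> w \<in> tangent_space A p \<Longrightarrow> R p (v + w) = R p v + R p w"
  using endo_field_linear[of R v p w 1 1] by simp

lemma endo_field_scale:
  "endo_field A R \<Longrightarrow> v \<in> tangent_space A p \<Longrightarrow> R p (a *\<^sub>R v) = a *\<^sub>R R p v"
  using endo_field_linear[of R v p v a 0] by simp

text \<open>In a chart, \<open>R\<close> becomes a family of linear maps that is smooth on constant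
  vectors; it is applied to the smooth coordinates of \<open>X\<close>.\<close>

lemma endo_apply_in_vector_fields:
  assumes R: "endo_field A R" and X: "X \<in> vector_fields A"
  shows "endo_apply R X \<in> vector_fields A"
proof -
  have "smooth_on (snd c ` fst c) (\<lambda>x. endo_apply R X (chart_inv c x) c)" if c: "c \<in> A" for c
  proof (rule smooth_on_cong[OF open_chart_codomain[OF c]])
    let ?l = "\<lambda>x u. R (chart_inv c x) (coord_vector A c u (chart_inv c x)) c"
    show "smooth_on (snd c ` fst c) (\<lambda>x. ?l x (X (chart_inv c x) c))"
    proof (rule smooth_on_linear_apply[where l = ?l, OF open_chart_codomain[OF c]])
      fix x assume "x \<in> snd c ` fst c"
      then obtain p where p: "p \<in> fst c" "chart_inv c x = p" using c by auto
      show "linear (?l x)"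
      proof (rule linearI)
        show "?l x (u + w) = ?l x u + ?l x w" for u w
          by (simp only: p(2) coord_vector_add[OF c p(1)] plus_fun_apply
              endo_field_add[OF R coord_vector_in_tangent_space coord_vector_in_tangent_space, OF c p(1) c p(1)])
        show "?l x (a *\<^sub>R u) = a *\<^sub>R ?l x u" for a u
          by (simp only: p(2) coord_vector_scale[OF c p(1)]
              endo_field_scale[OF R coord_vector_in_tangent_space, OF c p(1)]) (simp only: scaleR_fun_def)
      qed
    qed (use R X c in \<open>auto simp: endo_field_def vector_fields_def\<close>)
    show "?l x (X (chart_inv c x) c) = endo_apply R X (chart_inv c x) c" if "x \<in> snd c ` fst c" for x
      using that c coord_vector_tangent[OF vector_field_tangent[OF X] c]
      by (auto simp: endo_apply_def)
  qed
  then show ?thesis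
    using R X by (simp add: vector_fields_def endo_apply_def endo_field_def)
qed

end

locale riemannian = smooth_manifold A
  for A :: "('m::topological_space, 'e::euclidean_space) chart set" +
  fixes g :: "'m \<Rightarrow> ('m, 'e) tangent \<Rightarrow> ('m, 'e) tangent \<Rightarrow> real"
  assumes metric: "riemannian_metric A g"
begin

section \<open>Pointwise algebra of the metric and orthogonal complements\<close>

lemma metric_commute:
  "v \<in> tangent_space A p \<Longrightarrow> w \<in> tangent_space A p \<Longrightarrow> g p v w = g p w v"
  using metric by (simp add: riemannian_metric_def)

lemma metric_linear_left:
  assumes "u \<in> tangent_space A p" "v \<in> tangent_space A p" "w \<in> tangent_space A p"
  shows "g p (a *\<^sub>R u + b *\<^sub>R v) w = a * g p u w + b * g p v w"
  using metric assms by (simp add: riemannian_metric_def)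

lemma metric_pos: "v \<in> tangent_space A p \<Longrightarrow> v \<noteq> 0 \<Longrightarrow> g p v v > 0"
  using metric by (simp add: riemannian_metric_def)

lemma metric_add_left:
  assumes "u \<in> tangent_space A p" "v \<in> tangent_space A p" "w \<in> tangent_space A p"
  shows "g p (u + v) w = g p u w + g p v w"
  using metric_linear_left[OF assms, of 1 1] by simp

lemma metric_diff_left:
  assumes "u \<in> tangent_space A p" "v \<in> tangent_space A p" "w \<in> tangent_space A p"
  shows "g p (u - v) w = g p u w - g p v w"
  using metric_linear_left[OF assms, of 1 "-1"] by simp

lemma metric_scale_left:
  "v \<in> tangent_space A p \<Longrightarrow> w \<in> tangent_space A p \<Longrightarrow> g p (a *\<^sub>R v) w = a * g p v w"
  using metric_linear_left[of v p v w a 0] by simp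

lemma metric_zero_left: "w \<in> tangent_space A p \<Longrightarrow> g p 0 w = 0"
  using metric_diff_left[of w p w w] by simp

lemma metric_add_right:
  assumes "u \<in> tangent_space A p" "v \<in> tangent_space A p" "w \<in> tangent_space A p"
  shows "g p w (u + v) = g p w u + g p w v"
  using metric_add_left[OF assms] assms subspace_tangent_space[of p]
  by (simp add: metric_commute[of w] subspace_add)

lemma subspace_orth_dist:
  assumes "D p \<subseteq> tangent_space A p"
  shows "subspace (orth_dist A g D p)"
proof (rule subspaceI)
  show "0 \<in> orth_dist A g D p"
    using assms subspace_tangent_space
    by (auto simp: orth_dist_def metric_zero_left subspace_0)
  fix v assume v: "v \<in> orth_dist A g D p"
  { fix w assume "w \<in> orth_dist A g D p"
    with v assms show "v + w \<in> orth_dist A g D p"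
      using subspace_tangent_space
      by (auto simp: orth_dist_def subset_iff metric_add_left subspace_add) }
  fix a
  from v assms show "a *\<^sub>R v \<in> orth_dist A g D p"
    using subspace_tangent_space
    by (auto simp: orth_dist_def subset_iff subspace_scale metric_scale_left)
qed

text \<open>\<open>ver\<close> is a definite description, so evaluating it requires uniqueness: the
  difference of two candidates lies in \<open>D p\<close> and is orthogonal to \<open>D p\<close>,
  hence to itself.\<close>

lemma ver_eqI:
  assumes D: "subspace (D p)" "D p \<subseteq> tangent_space A p"
    and v: "v \<in> D p" "U p - v \<in> orth_dist A g D p"
  shows "ver A g D U p = v"
  unfolding ver_def
proof (rule the_equality)
  fix w assume w: "w \<in> D p \<and> U p - w \<in> orth_dist A g D p"
  then have "(U p - v) - (U p - w) \<in> orth_dist A g D p"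
    using v(2) D(2) by (intro subspace_diff[OF subspace_orth_dist, of D p "U p - v" "U p - w"]) auto
  moreover have "w - v \<in> D p"
    using w v D(1) by (intro subspace_diff) auto
  ultimately have "g p (w - v) (w - v) = 0" "w - v \<in> tangent_space A p"
    using D(2) by (auto simp: orth_dist_def)
  then have "w - v = 0"
    using metric_pos by fastforce
  then show "w = v" by simp
qed (use v in simp)

text \<open>Makes the Euclidean projection results available for the metric on any open part of a
  chart image.\<close>

lemma smooth_inner_products_chart:
  assumes "c \<in> A" "open T" "T \<subseteq> snd c ` fst c"
  shows "smooth_inner_products T
    (\<lambda>x u w. g (chart_inv c x) (coord_vector A c u (chart_inv c x)) (coord_vector A c w (chart_inv c x)))"
proof (rule smooth_inner_products.intro)
  fix x assume "x \<in> T"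
  then obtain p where p: "p \<in> fst c" "x = snd c p" "chart_inv c x = p"
    using assms by auto
  note T = coord_vector_in_tangent_space[OF assms(1) p(1)]
  show "linear (\<lambda>u. g (chart_inv c x) (coord_vector A c u (chart_inv c x)) (coord_vector A c w (chart_inv c x)))" for w
    by (rule linearI) (simp_all only: p(3) coord_vector_add[OF assms(1) p(1)] metric_add_left[OF T T T]
        coord_vector_scale[OF assms(1) p(1)] metric_scale_left[OF T T] real_scaleR_def)
  show "g (chart_inv c x) (coord_vector A c u (chart_inv c x)) (coord_vector A c w (chart_inv c x)) =
     g (chart_inv c x) (coord_vector A c w (chart_inv c x)) (coord_vector A c u (chart_inv c x))" for u w
    using metric_commute[OF T T] p by simp
  show "g (chart_inv c x) (coord_vector A c u (chart_inv c x)) (coord_vector A c u (chart_inv c x)) > 0"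
    if "u \<noteq> 0" for u
  proof -
    have "coord_vector A c u p \<noteq> 0"
      using coord_vector_self[OF assms(1) p(1), of u] that by auto
    then show ?thesis using metric_pos[OF T] p by simp
  qed
next
  show "smooth_on T (\<lambda>x. g (chart_inv c x) (coord_vector A c u (chart_inv c x)) (coord_vector A c w (chart_inv c x)))" for u w
    by (rule smooth_on_subset[OF _ assms(3)]) (use metric assms(1) in \<open>simp add: riemannian_metric_def\<close>)
qed (rule assms)

end

section \<open>Vertical and horizontal fields of a submersion\<close>

locale submersion = riemannian A g + N: smooth_manifold B
  for A :: "('m::topological_space, 'e::euclidean_space) chart set"
    and g :: "'m \<Rightarrow> ('m, 'e) tangent \<Rightarrow> ('m, 'e) tangent \<Rightarrow> real"
    and B :: "('n::topological_space, 'f::euclidean_space) chart set" +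
  fixes h :: "'n \<Rightarrow> ('n, 'f) tangent \<Rightarrow> ('n, 'f) tangent \<Rightarrow> real"
    and F :: "'m \<Rightarrow> 'n"
  assumes submersion: "riemannian_submersion A g B h F"
begin

abbreviation "Ver \<equiv> ker_dist A B F"
abbreviation "Hor \<equiv> orth_dist A g Ver"

lemma smooth_coord_map:
  "c \<in> A \<Longrightarrow> d \<in> B \<Longrightarrow> smooth_on (snd c ` (fst c \<inter> F -` fst d)) (snd d \<circ> F \<circ> chart_inv c)"
  using submersion by (simp add: riemannian_submersion_def smooth_map_def)

lemma open_coord_domain:
  assumes "c \<in> A" "d \<in> B"
  shows "open (snd c ` (fst c \<inter> F -` fst d))"
proof -
  have "continuous_on UNIV F"
    using submersion by (simp add: riemannian_submersion_def smooth_map_def)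
  then have "open (F -` fst d)"
    using N.open_chart_domain[OF assms(2)] by (metis open_vimage)
  then show ?thesis by (rule open_chart_image[OF assms(1)])
qed

text \<open>\<open>pushforward\<close> is defined through the chosen chart \<open>chart_at\<close>;
  the chain rule replaces it by any chart around \<open>p\<close>.\<close>

lemma pushforward_chart:
  assumes c: "c \<in> A" "p \<in> fst c" and d: "d \<in> B" "F p \<in> fst d" and v: "v \<in> tangent_space A p"
  shows "pushforward A B F p v d = frechet_derivative (snd d \<circ> F \<circ> chart_inv c) (at (snd c p)) (v c)"
proof -
  let ?a = "chart_at A p"
  have "((snd d \<circ> F \<circ> chart_inv c) has_derivative
      frechet_derivative (snd d \<circ> F \<circ> chart_inv c) (at (snd c p))) (at (snd c p))"
    by (rule smooth_on_has_derivative[OF smooth_coord_map[OF c(1) d(1)]]) (use c d in simp)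
  from has_derivative_change_chart[OF chart_at(1) c(1) chart_at(2) c(2) this, THEN frechet_derivative_at]
  have "frechet_derivative (snd d \<circ> F \<circ> chart_inv ?a) (at (snd ?a p)) (v ?a) =
      frechet_derivative (snd d \<circ> F \<circ> chart_inv c) (at (snd c p)) (v c)"
    using tangent_change_chart[OF v chart_at(1) c(1) chart_at(2) c(2)] by (metis comp_apply)
  then show ?thesis
    using d by (simp add: pushforward_def Let_def)
qed

lemma pushforward_image: "pushforward A B F p ` tangent_space A p = tangent_space B (F p)"
  using submersion by (simp add: riemannian_submersion_def)

text \<open>A tangent vector of the target vanishes as soon as its coordinates in one chart do, so a
  single chart \<open>d\<close> decides membership in the kernel.\<close>

lemma ker_dist_chart_iff:
  assumes c: "c \<in> A" "p \<in> fst c" and d: "d \<in> B" "F p \<in> fst d" and v: "v \<in> tangent_space A p"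
  shows "v \<in> Ver p \<longleftrightarrow> frechet_derivative (snd d \<circ> F \<circ> chart_inv c) (at (snd c p)) (v c) = 0"
proof -
  have "pushforward A B F p v \<in> tangent_space B (F p)"
    using pushforward_image v by blast
  then have "pushforward A B F p v = 0 \<longleftrightarrow> pushforward A B F p v d = 0"
    using N.coord_vector_tangent[OF _ d] linear_0[OF N.linear_coord_vector[OF d]]
    by (metis zero_fun_apply)
  then show ?thesis
    using v by (simp add: ker_dist_def pushforward_chart[OF assms])
qed

lemma surj_coord_derivative:
  assumes c: "c \<in> A" "p \<in> fst c" and d: "d \<in> B" "F p \<in> fst d"
  shows "surj (frechet_derivative (snd d \<circ> F \<circ> chart_inv c) (at (snd c p)))"
  unfolding surj_def
proof
  fix y
  obtain v where v: "v \<in> tangent_space A p" "pushforward A B F p v = coord_vector B d y (F p)"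
    using N.coord_vector_in_tangent_space[OF d] pushforward_image by (metis imageE)
  show "\<exists>u. y = frechet_derivative (snd d \<circ> F \<circ> chart_inv c) (at (snd c p)) u"
    using pushforward_chart[OF assms v(1)] v(2) N.coord_vector_self[OF d] by metis
qed

section \<open>The vertical and horizontal subspaces and the smoothness of the projections\<close>

lemma Ver_tangent: "Ver p \<subseteq> tangent_space A p"
  by (simp add: ker_dist_def)

lemma Hor_tangent: "Hor p \<subseteq> tangent_space A p"
  by (simp add: orth_dist_def)

lemma subspace_Ver: "subspace (Ver p)"
proof -
  obtain c where c: "c \<in> A" "p \<in> fst c" using chart_exists by blast
  obtain d where d: "d \<in> B" "F p \<in> fst d" using N.chart_exists by blast
  let ?D = "frechet_derivative (snd d \<circ> F \<circ> chart_inv c) (at (snd c p))"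
  have lin: "linear ?D"
    by (rule has_derivative_linear[OF smooth_on_has_derivative[OF smooth_coord_map[OF c(1) d(1)]]])
      (use c d in simp)
  have *: "v \<in> Ver p \<longleftrightarrow> v \<in> tangent_space A p \<and> ?D (v c) = 0" for v
    using ker_dist_chart_iff[OF c d] Ver_tangent by blast
  show ?thesis
  proof (rule subspaceI)
    show "0 \<in> Ver p"
      unfolding * using subspace_0[OF subspace_tangent_space] linear_0[OF lin] by simp
    show "u + v \<in> Ver p" if "u \<in> Ver p" "v \<in> Ver p" for u v
      using that unfolding * by (simp add: subspace_add[OF subspace_tangent_space] linear_add[OF lin])
    show "a *\<^sub>R v \<in> Ver p" if "v \<in> Ver p" for a v
      using that subspace_scale[OF subspace_tangent_space[of p], of v a] unfolding *
      by (auto simp: scaleR_fun_def linear_scale[OF lin])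
  qed
qed

lemma subspace_Hor: "subspace (Hor p)"
  by (rule subspace_orth_dist) (rule Ver_tangent)

lemma ver_Ver_eqI: "v \<in> Ver p \<Longrightarrow> U p - v \<in> Hor p \<Longrightarrow> ver A g Ver U p = v"
  by (rule ver_eqI[OF subspace_Ver Ver_tangent])

text \<open>\<open>smooth_horizontal_part\<close> is applied to the coordinate expression of
  \<open>F\<close>. The field \<open>W\<close> is local because \<open>F\<close> has to map its
  domain into one chart of the target.\<close>

lemma smooth_horizontal_part_chart:
  assumes U: "U \<in> vector_fields A" and c: "c \<in> A" and p: "p \<in> fst c"
  shows "\<exists>T W. open T \<and> snd c p \<in> T \<and> T \<subseteq> snd c ` fst c \<and> smooth_on T W \<and>
    (\<forall>q\<in>fst c. snd c q \<in> T \<longrightarrow> coord_vector A c (W (snd c q)) q \<in> Hor q \<and>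
       U q - coord_vector A c (W (snd c q)) q \<in> Ver q)"
proof -
  obtain d where d: "d \<in> B" "F p \<in> fst d" using N.chart_exists by blast
  let ?T = "snd c ` (fst c \<inter> F -` fst d)"
  let ?\<phi> = "snd d \<circ> F \<circ> chart_inv c"
  let ?G = "\<lambda>x u w. g (chart_inv c x) (coord_vector A c u (chart_inv c x)) (coord_vector A c w (chart_inv c x))"
  \<comment> \<open>\<open>?T\<close> is an image, so injectivity of the chart is needed to return
    from coordinates to the point.\<close>
  have dom: "F q \<in> fst d" if q: "q \<in> fst c" "snd c q \<in> ?T" for q
  proof -
    obtain q' where "q' \<in> fst c" "F q' \<in> fst d" "snd c q = snd c q'" using q(2) by blast
    then show ?thesis using chart_inv[OF c] q(1) by metis
  qed
  have "surj (frechet_derivative ?\<phi> (at x))" if "x \<in> ?T" for x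
    using that surj_coord_derivative[OF c _ d(1)] by auto
  moreover have "smooth_on ?T (\<lambda>x. U (chart_inv c x) c)"
    by (rule smooth_on_subset[of "snd c ` fst c"]) (use U c in \<open>auto simp: vector_fields_def\<close>)
  moreover have "smooth_inner_products ?T ?G"
    by (rule smooth_inner_products_chart[OF c open_coord_domain[OF c d(1)]]) auto
  ultimately obtain W where W: "smooth_on ?T W"
      "\<And>x. x \<in> ?T \<Longrightarrow> frechet_derivative ?\<phi> (at x) (U (chart_inv c x) c - W x) = 0"
      "\<And>x w. x \<in> ?T \<Longrightarrow> frechet_derivative ?\<phi> (at x) w = 0 \<Longrightarrow> ?G x (W x) w = 0"
    using smooth_inner_products.smooth_horizontal_part[OF _ smooth_coord_map[OF c d(1)],
        of ?G "\<lambda>x. U (chart_inv c x) c"] by blast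
  have "coord_vector A c (W (snd c q)) q \<in> Hor q \<and> U q - coord_vector A c (W (snd c q)) q \<in> Ver q"
    if q: "q \<in> fst c" "snd c q \<in> ?T" for q
  proof -
    let ?W = "coord_vector A c (W (snd c q)) q"
    note TW = coord_vector_in_tangent_space[OF c q(1), of "W (snd c q)"]
    have "g q ?W w = 0" if w: "w \<in> Ver q" for w
    proof -
      have "w \<in> tangent_space A q" using w Ver_tangent by blast
      then have "frechet_derivative ?\<phi> (at (snd c q)) (w c) = 0"
        using ker_dist_chart_iff[OF c q(1) d(1) dom[OF q]] w by blast
      then have "g q ?W (coord_vector A c (w c) q) = 0"
        using W(3)[OF q(2)] chart_inv[OF c q(1)] by simp
      then show ?thesis
        using coord_vector_tangent[OF \<open>w \<in> tangent_space A q\<close> c q(1)] by simp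
    qed
    then have "?W \<in> Hor q" using TW by (simp add: orth_dist_def)
    moreover have "U q - ?W \<in> tangent_space A q"
      by (rule subspace_diff[OF subspace_tangent_space vector_field_tangent[OF U] TW])
    then have "U q - ?W \<in> Ver q"
      using ker_dist_chart_iff[OF c q(1) d(1) dom[OF q]] W(2)[OF q(2)] chart_inv[OF c q(1)]
        coord_vector_self[OF c q(1)] by simp
    ultimately show ?thesis by blast
  qed
  then show ?thesis
    using W(1) open_coord_domain[OF c d(1)] p d(2) by (intro exI[of _ ?T] exI[of _ W]) auto
qed

text \<open>Existence of the decomposition, taken from the local field at \<open>p\<close>;
  uniqueness then identifies it with \<open>ver\<close> and \<open>hor\<close>.\<close>

lemma
  assumes U: "U \<in> vector_fields A"
  shows ver_in_Ver: "ver A g Ver U p \<in> Ver p" and hor_in_Hor: "hor A g Ver U p \<in> Hor p"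
proof -
  obtain c where c: "c \<in> A" "p \<in> fst c" using chart_exists by blast
  obtain w where w: "w \<in> Hor p" "U p - w \<in> Ver p"
    using smooth_horizontal_part_chart[OF U c] c(2) by blast
  then have "ver A g Ver U p = U p - w"
    by (intro ver_Ver_eqI) simp_all
  then show "ver A g Ver U p \<in> Ver p" "hor A g Ver U p \<in> Hor p"
    using w by (simp_all add: hor_def)
qed

text \<open>By uniqueness of the decomposition, the local smooth field \<open>W\<close> is the
  coordinate expression of the horizontal part, and smoothness is a local property.\<close>

lemma hor_in_vector_fields:
  assumes U: "U \<in> vector_fields A"
  shows "hor A g Ver U \<in> vector_fields A"
proof -
  have "smooth_on (snd c ` fst c) (\<lambda>x. hor A g Ver U (chart_inv c x) c)" if c: "c \<in> A" for c
  proof (rule smooth_on_locally)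
    fix x assume "x \<in> snd c ` fst c"
    then obtain p where p: "p \<in> fst c" "x = snd c p" by blast
    obtain T W where T: "open T" "snd c p \<in> T" "T \<subseteq> snd c ` fst c" and W: "smooth_on T W"
      and TW: "\<And>q. q \<in> fst c \<Longrightarrow> snd c q \<in> T \<Longrightarrow> coord_vector A c (W (snd c q)) q \<in> Hor q \<and>
         U q - coord_vector A c (W (snd c q)) q \<in> Ver q"
      using smooth_horizontal_part_chart[OF U c p(1)] by blast
    have "W y = hor A g Ver U (chart_inv c y) c" if "y \<in> T" for y
    proof -
      obtain q where q: "q \<in> fst c" "y = snd c q" using T(3) \<open>y \<in> T\<close> by blast
      have "ver A g Ver U q = U q - coord_vector A c (W y) q"
        using TW[OF q(1)] that q(2) by (intro ver_Ver_eqI) simp_all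
      then show ?thesis
        using coord_vector_self[OF c q(1)] q chart_inv[OF c q(1)] by (simp add: hor_def)
    qed
    then have "smooth_on T (\<lambda>x. hor A g Ver U (chart_inv c x) c)"
      by (rule smooth_on_cong[OF T(1) _ W])
    then show "\<exists>T. open T \<and> x \<in> T \<and> smooth_on T (\<lambda>x. hor A g Ver U (chart_inv c x) c)"
      using T p by blast
  qed
  moreover have "hor A g Ver U p \<in> tangent_space A p" for p
    using hor_in_Hor[OF U] Hor_tangent by blast
  ultimately show ?thesis
    by (simp add: vector_fields_def)
qed

lemma hor_in_sections: "U \<in> vector_fields A \<Longrightarrow> hor A g Ver U \<in> sections A Hor"
  by (simp add: sections_def hor_in_vector_fields hor_in_Hor)

lemma ver_in_sections:
  assumes "U \<in> vector_fields A"
  shows "ver A g Ver U \<in> sections A Ver"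
proof -
  have "U - hor A g Ver U = ver A g Ver U" by (simp add: hor_def)
  then have "ver A g Ver U \<in> vector_fields A"
    using vector_fields_diff[OF assms hor_in_vector_fields[OF assms]] by simp
  then show ?thesis
    using assms by (simp add: sections_def ver_in_Ver)
qed

lemma ver_plus_hor: "U = ver A g Ver U + hor A g Ver U"
  by (simp add: hor_def)

lemma
  assumes "U \<in> sections A Ver"
  shows ver_vertical: "ver A g Ver U = U" and hor_vertical: "hor A g Ver U = 0"
proof -
  show "ver A g Ver U = U"
    by (rule ext, rule ver_Ver_eqI) (use assms in \<open>simp_all add: sections_def subspace_0[OF subspace_Hor]\<close>)
  then show "hor A g Ver U = 0" by (simp add: hor_def)
qed

lemma
  assumes "U \<in> sections A Hor"
  shows ver_horizontal: "ver A g Ver U = 0" and hor_horizontal: "hor A g Ver U = U"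
proof -
  \<comment> \<open>The type constraint on \<open>zero_fun_def\<close> unfolds the zero vector field
    while leaving the zero tangent vector folded.\<close>
  show "ver A g Ver U = 0"
    by (rule ext, unfold zero_fun_def[where 'b = "('m, 'e) tangent"], rule ver_Ver_eqI)
      (use assms in \<open>simp_all add: sections_def subspace_0[OF subspace_Ver]\<close>)
  then show "hor A g Ver U = U" by (simp add: hor_def)
qed

lemma metric_Hor_Ver: "v \<in> Hor p \<Longrightarrow> w \<in> Ver p \<Longrightarrow> g p v w = 0"
  by (simp add: orth_dist_def)

lemma totally_geodesic_iff:
  assumes lc: "levi_civita A g nabla"
  shows "totally_geodesic_foliation A nabla Hor \<longleftrightarrow>
    (\<forall>V\<in>sections A Ver. \<forall>X\<in>sections A Hor. \<forall>Y\<in>sections A Hor. \<forall>p. g p (nabla X Y p) (V p) = 0)"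
proof
  assume "totally_geodesic_foliation A nabla Hor"
  then show "\<forall>V\<in>sections A Ver. \<forall>X\<in>sections A Hor. \<forall>Y\<in>sections A Hor. \<forall>p. g p (nabla X Y p) (V p) = 0"
    unfolding totally_geodesic_foliation_def by (simp add: sections_def metric_Hor_Ver)
next
  assume *: "\<forall>V\<in>sections A Ver. \<forall>X\<in>sections A Hor. \<forall>Y\<in>sections A Hor. \<forall>p. g p (nabla X Y p) (V p) = 0"
  have "nabla X Y \<in> sections A Hor" if X: "X \<in> sections A Hor" and Y: "Y \<in> sections A Hor" for X Y
  proof -
    let ?U = "nabla X Y"
    have U: "?U \<in> vector_fields A"
      using lc X Y by (simp add: levi_civita_def affine_connection_def sections_def)
    have "ver A g Ver ?U p = 0" for p
    proof -
      have T: "ver A g Ver ?U p \<in> tangent_space A p" "hor A g Ver ?U p \<in> tangent_space A p"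
        using ver_in_Ver[OF U] hor_in_Hor[OF U] Ver_tangent Hor_tangent by blast+
      \<comment> \<open>The test field is the vertical part of \<open>nabla X Y\<close> itself,
        admissible because it is a smooth section.\<close>
      have "g p (?U p) (ver A g Ver ?U p) = 0"
        using * ver_in_sections[OF U] X Y by blast
      moreover have "?U p = ver A g Ver ?U p + hor A g Ver ?U p"
        by (simp add: hor_def)
      moreover have "g p (hor A g Ver ?U p) (ver A g Ver ?U p) = 0"
        using metric_Hor_Ver hor_in_Hor[OF U] ver_in_Ver[OF U] by blast
      ultimately have "g p (ver A g Ver ?U p) (ver A g Ver ?U p) = 0"
        using metric_add_left[OF T T(1)] by simp
      then show ?thesis using metric_pos[OF T(1)] by fastforce
    qed
    then have "hor A g Ver ?U = ?U" by (simp add: hor_def fun_eq_iff)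
    then show ?thesis using hor_in_sections[OF U] by simp
  qed
  then show "totally_geodesic_foliation A nabla Hor"
    by (simp add: totally_geodesic_foliation_def)
qed

section \<open>Anti-invariant submersions\<close>

text \<open>The second summand of the O'Neill tensor differentiates the horizontal part of
  \<open>V\<close>, which is the zero field.\<close>

lemma oneill_A_Hor_Ver:
  assumes lc: "levi_civita A g nabla" and X: "X \<in> sections A Hor" and V: "V \<in> sections A Ver"
  shows "oneill_A A g nabla Ver X V = hor A g Ver (nabla X V)"
proof -
  have "X \<in> vector_fields A" using X by (simp add: sections_def)
  \<comment> \<open>Additivity in the second argument forces \<open>nabla X 0 = 0\<close>.\<close>
  then have "nabla X (0 + 0) = nabla X 0 + nabla X 0"
    using lc vector_fields_zero unfolding levi_civita_def affine_connection_def by blast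
  then have "nabla X 0 = 0" by simp
  moreover have "0 \<in> sections A Hor"
    by (simp add: sections_def vector_fields_zero subspace_0[OF subspace_Hor])
  ultimately show ?thesis
    by (simp add: oneill_A_def hor_horizontal[OF X] ver_vertical[OF V] hor_vertical[OF V]
        ver_horizontal[of 0])
qed

text \<open>The right-hand side is the difference of the two sides of the condition for
  \<open>R\<close>, while the left-hand side does not involve \<open>R\<close>. This is what links
  the conditions for different \<open>R\<close>.\<close>

lemma metric_nabla_oneill_A:
  assumes lc: "levi_civita A g nabla" and R: "endo_field A R"
    and isometric: "\<And>p v w. v \<in> tangent_space A p \<Longrightarrow> w \<in> tangent_space A p \<Longrightarrow> g p (R p v) (R p w) = g p v w"
    and parallel: "\<And>X Y. X \<in> vector_fields A \<Longrightarrow> Y \<in> vector_fields A \<Longrightarrow>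
      nabla X (endo_apply R Y) = endo_apply R (nabla X Y)"
    and anti_invariant: "\<And>p. R p ` Ver p \<subseteq> Hor p"
    and V: "V \<in> sections A Ver" and X: "X \<in> sections A Hor" and Y: "Y \<in> sections A Hor"
  shows "g p (nabla X Y p) (V p) =
    g p (oneill_A A g nabla Ver X (B_part A g Ver R Y) p) (R p (V p)) -
    g p (C_part A g Ver R Y p) (R p (oneill_A A g nabla Ver X V p))"
proof -
  have fields: "X \<in> vector_fields A" "Y \<in> vector_fields A" "V \<in> vector_fields A"
    using X Y V by (simp_all add: sections_def)
  note RV = endo_apply_in_vector_fields[OF R fields(3)]
  note RY = endo_apply_in_vector_fields[OF R fields(2)]
  have nabla: "nabla Z W \<in> vector_fields A" if "Z \<in> vector_fields A" "W \<in> vector_fields A" for Z W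
    using lc that unfolding levi_civita_def affine_connection_def by blast
  define BY where "BY = B_part A g Ver R Y"
  define CY where "CY = C_part A g Ver R Y"
  have BY: "BY \<in> sections A Ver" and CY: "CY \<in> sections A Hor"
    unfolding BY_def CY_def B_part_def C_part_def
    by (rule ver_in_sections[OF RY], rule hor_in_sections[OF RY])
  then have fields': "BY \<in> vector_fields A" "CY \<in> vector_fields A"
    by (simp_all add: sections_def)
  have RY_eq: "endo_apply R Y = BY + CY"
    unfolding BY_def CY_def B_part_def C_part_def by (rule ver_plus_hor)
  have R_Ver: "R q v \<in> Hor q" if "v \<in> Ver q" for q v
    using anti_invariant that by blast
  have V_Ver: "V q \<in> Ver q" for q using V by (simp add: sections_def)
  have Hor_T: "v \<in> tangent_space A q" if "v \<in> Hor q" for q v using that Hor_tangent by blast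
  have Ver_T: "v \<in> tangent_space A q" if "v \<in> Ver q" for q v using that Ver_tangent by blast
  \<comment> \<open>\<open>R v\<close> is orthogonal to \<open>R Y\<close> because \<open>R\<close>
    is an isometry, and to \<open>BY\<close> because \<open>R v\<close> is horizontal; what remains
    of \<open>R Y\<close> is \<open>CY\<close>.\<close>
  have C_orth: "g q (CY q) (R q v) = 0" if v: "v \<in> Ver q" for q v
  proof -
    have Yq: "Y q \<in> Hor q" and Bq: "BY q \<in> Ver q" and Cq: "CY q \<in> Hor q"
      using Y BY CY by (simp_all add: sections_def)
    have "R q (Y q) = BY q + CY q"
      using RY_eq by (metis endo_apply_def plus_fun_apply)
    moreover have "g q (R q (Y q)) (R q v) = 0"
      using isometric[OF Hor_T[OF Yq] Ver_T[OF v]] metric_Hor_Ver[OF Yq v] by simp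
    moreover have "g q (BY q) (R q v) = 0"
      using metric_Hor_Ver[OF R_Ver[OF v] Bq] metric_commute Hor_T[OF R_Ver[OF v]] Ver_T[OF Bq] by simp
    ultimately show ?thesis
      using metric_add_left[OF Ver_T[OF Bq] Hor_T[OF Cq] Hor_T[OF R_Ver[OF v]]] by simp
  qed
  \<comment> \<open>Metric compatibility for the pair \<open>CY\<close>, \<open>RV\<close>, whose
    inner product is constantly zero by \<open>C_orth\<close>.\<close>
  have "vf_deriv A X (\<lambda>q. g q (CY q) (endo_apply R V q)) p =
      g p (nabla X CY p) (endo_apply R V p) + g p (CY p) (nabla X (endo_apply R V) p)"
    by (rule lc[unfolded levi_civita_def, THEN conjunct2, THEN conjunct2, rule_format,
          OF fields(1) fields'(2) RV, THEN fun_cong])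
  moreover have "(\<lambda>q. g q (CY q) (endo_apply R V q)) = (\<lambda>q. 0)"
    using C_orth V_Ver by (simp add: endo_apply_def)
  moreover have "vf_deriv A X (\<lambda>q. 0) p = 0"
    by (simp add: vf_deriv_def dir_deriv_def Let_def o_def frechet_derivative_const)
  ultimately have compat: "g p (nabla X CY p) (R p (V p)) = - g p (CY p) (R p (nabla X V p))"
    using parallel[OF fields(1,3)] by (simp add: endo_apply_def)
  have ver_hor: "U q = ver A g Ver U q + hor A g Ver U q" for U :: "('m, 'e) vfield" and q
    by (simp add: hor_def)
  let ?NV = "nabla X V" and ?NB = "nabla X BY"
  note NV = nabla[OF fields(1,3)] and NB = nabla[OF fields(1) fields'(1)]
  \<comment> \<open>By \<open>C_orth\<close>, the vertical part of \<open>nabla X V\<close> drops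
    out; its horizontal part is the O'Neill term.\<close>
  have "R p (?NV p) = R p (ver A g Ver ?NV p) + R p (hor A g Ver ?NV p)"
    using endo_field_add[OF R Ver_T[OF ver_in_Ver[OF NV]] Hor_T[OF hor_in_Hor[OF NV]], of p]
      ver_hor[of ?NV p] by simp
  then have "g p (CY p) (R p (?NV p)) = g p (CY p) (R p (hor A g Ver ?NV p))"
    using metric_add_right[OF endo_field_tangent[OF R Ver_T[OF ver_in_Ver[OF NV]]]
        endo_field_tangent[OF R Hor_T[OF hor_in_Hor[OF NV]]] vector_field_tangent[OF fields'(2)], of p]
      C_orth[OF ver_in_Ver[OF NV]] by simp
  then have C: "g p (nabla X CY p) (R p (V p)) = - g p (CY p) (R p (oneill_A A g nabla Ver X V p))"
    using compat oneill_A_Hor_Ver[OF lc X V] by simp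
  note RVp = R_Ver[OF V_Ver[of p]]
  \<comment> \<open>Since \<open>R p (V p)\<close> is horizontal, only the horizontal part of
    \<open>nabla X BY\<close> counts, and this is again an O'Neill term because \<open>BY\<close> is
    vertical.\<close>
  have "g p (ver A g Ver ?NB p) (R p (V p)) = 0"
    using metric_Hor_Ver[OF RVp ver_in_Ver[OF NB]] metric_commute Hor_T[OF RVp]
      Ver_T[OF ver_in_Ver[OF NB]] by simp
  then have B: "g p (?NB p) (R p (V p)) = g p (oneill_A A g nabla Ver X BY p) (R p (V p))"
    using metric_add_left[OF Ver_T[OF ver_in_Ver[OF NB]] Hor_T[OF hor_in_Hor[OF NB]] Hor_T[OF RVp]]
      ver_hor[of ?NB p] oneill_A_Hor_Ver[OF lc X BY] by simp
  \<comment> \<open>Parallelism turns \<open>R p (nabla X Y p)\<close> into the derivative of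
    \<open>RY\<close>, which is split along \<open>BY\<close> and \<open>CY\<close>.\<close>
  have "nabla X (BY + CY) = ?NB + nabla X CY"
    using lc fields(1) fields' unfolding levi_civita_def affine_connection_def by blast
  then have "R p (nabla X Y p) = ?NB p + nabla X CY p"
    using parallel[OF fields(1,2)] RY_eq by (metis endo_apply_def plus_fun_apply)
  then have "g p (nabla X Y p) (V p) = g p (?NB p + nabla X CY p) (R p (V p))"
    using isometric[OF vector_field_tangent[OF nabla[OF fields(1,2)]] Ver_T[OF V_Ver], of p] by simp
  also have "\<dots> = g p (?NB p) (R p (V p)) + g p (nabla X CY p) (R p (V p))"
    by (rule metric_add_left[OF vector_field_tangent[OF NB]
          vector_field_tangent[OF nabla[OF fields(1) fields'(2)]] Hor_T[OF RVp]])
  finally show ?thesis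
    using B C by (simp add: BY_def CY_def)
qed

lemma totally_geodesic_iff_oneill_A:
  assumes lc: "levi_civita A g nabla" and R: "endo_field A R"
    and isometric: "\<And>p v w. v \<in> tangent_space A p \<Longrightarrow> w \<in> tangent_space A p \<Longrightarrow> g p (R p v) (R p w) = g p v w"
    and parallel: "\<And>X Y. X \<in> vector_fields A \<Longrightarrow> Y \<in> vector_fields A \<Longrightarrow>
      nabla X (endo_apply R Y) = endo_apply R (nabla X Y)"
    and anti_invariant: "\<And>p. R p ` Ver p \<subseteq> Hor p"
  shows "totally_geodesic_foliation A nabla Hor \<longleftrightarrow>
    (\<forall>V\<in>sections A Ver. \<forall>X\<in>sections A Hor. \<forall>Y\<in>sections A Hor. \<forall>p.
      g p (oneill_A A g nabla Ver X (B_part A g Ver R Y) p) (R p (V p)) =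
      g p (C_part A g Ver R Y p) (R p (oneill_A A g nabla Ver X V p)))"
  unfolding totally_geodesic_iff[OF lc]
  by (simp add: metric_nabla_oneill_A[OF assms])

end

theorem theorem3p11:
  fixes AM :: "('m::{t2_space, second_countable_topology}, 'e::euclidean_space) chart set"
    and gM :: "'m \<Rightarrow> ('m, 'e) tangent \<Rightarrow> ('m, 'e) tangent \<Rightarrow> real"
    and nabla :: "('m, 'e) vfield \<Rightarrow> ('m, 'e) vfield \<Rightarrow> ('m, 'e) vfield"
    and I J K :: "'m \<Rightarrow> ('m, 'e) tangent \<Rightarrow> ('m, 'e) tangent"
    and AN :: "('n::{t2_space, second_countable_topology}, 'f::euclidean_space) chart set"
    and gN :: "'n \<Rightarrow> ('n, 'f) tangent \<Rightarrow> ('n, 'f) tangent \<Rightarrow> real"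
    and F :: "'m \<Rightarrow> 'n"
    and Ver Hor :: "'m \<Rightarrow> ('m, 'e) tangent set"
    and \<A> :: "('m, 'e) vfield \<Rightarrow> ('m, 'e) vfield \<Rightarrow> ('m, 'e) vfield"
    and B C :: "('m \<Rightarrow> ('m, 'e) tangent \<Rightarrow> ('m, 'e) tangent) \<Rightarrow> ('m, 'e) vfield \<Rightarrow> ('m, 'e) vfield"
  defines "Ver \<equiv> ker_dist AM AN F"
    and "Hor \<equiv> orth_dist AM gM Ver"
    and "\<A> \<equiv> oneill_A AM gM nabla Ver"
    and "B \<equiv> B_part AM gM Ver"
    and "C \<equiv> C_part AM gM Ver"
  assumes "hyperkahler_manifold AM gM nabla I J K"
    and "riemannian_manifold AN gN"
    and "h_anti_invariant_submersion AM gM I J K AN gN F"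
  shows
    "(totally_geodesic_foliation AM nabla Hor \<longleftrightarrow>
       (\<forall>V\<in>sections AM Ver. \<forall>X\<in>sections AM Hor. \<forall>Y\<in>sections AM Hor. \<forall>p.
          gM p (\<A> X (B I Y) p) (I p (V p)) = gM p (C I Y p) (I p (\<A> X V p)))) \<and>
     (totally_geodesic_foliation AM nabla Hor \<longleftrightarrow>
       (\<forall>V\<in>sections AM Ver. \<forall>X\<in>sections AM Hor. \<forall>Y\<in>sections AM Hor. \<forall>p.
          gM p (\<A> X (B J Y) p) (J p (V p)) = gM p (C J Y p) (J p (\<A> X V p)))) \<and>
     (totally_geodesic_foliation AM nabla Hor \<longleftrightarrow>
       (\<forall>V\<in>sections AM Ver. \<forall>X\<in>sections AM Hor. \<forall>Y\<in>sections AM Hor. \<forall>p.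
          gM p (\<A> X (B K Y) p) (K p (V p)) = gM p (C K Y p) (K p (\<A> X V p))))"
proof -
  note hyperkahler = \<open>hyperkahler_manifold AM gM nabla I J K\<close>[unfolded hyperkahler_manifold_def]
  note anti = \<open>h_anti_invariant_submersion AM gM I J K AN gN F\<close>[unfolded h_anti_invariant_submersion_def]
  interpret submersion AM gM AN gN F
    using hyperkahler anti \<open>riemannian_manifold AN gN\<close>
    by unfold_locales (simp_all add: riemannian_manifold_def)
  \<comment> \<open>The argument is uniform in the complex structure; the three equivalences are its
    instances at \<open>I\<close>, \<open>J\<close> and \<open>K\<close>.\<close>
  have "totally_geodesic_foliation AM nabla Hor \<longleftrightarrow>
       (\<forall>V\<in>sections AM Ver. \<forall>X\<in>sections AM Hor. \<forall>Y\<in>sections AM Hor. \<forall>p.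
          gM p (\<A> X (B R Y) p) (R p (V p)) = gM p (C R Y p) (R p (\<A> X V p)))"
    if R: "R \<in> {I, J, K}" for R
    unfolding Hor_def Ver_def \<A>_def B_def C_def
  proof (rule totally_geodesic_iff_oneill_A)
    show "levi_civita AM gM nabla" using hyperkahler by blast
    show "endo_field AM R" using hyperkahler R by blast
    show "gM p (R p v) (R p w) = gM p v w"
      if "v \<in> tangent_space AM p" "w \<in> tangent_space AM p" for p v w
      using hyperkahler R that by blast
    show "nabla X (endo_apply R Y) = endo_apply R (nabla X Y)"
      if "X \<in> vector_fields AM" "Y \<in> vector_fields AM" for X Y
    proof -
      have "nabla X (endo_apply R Y) - endo_apply R (nabla X Y) = 0"
        using hyperkahler R that by blast
      then show ?thesis by simp
    qed
    show "R p ` ker_dist AM AN F p \<subseteq> orth_dist AM gM (ker_dist AM AN F) p" for p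
      using anti R by blast
  qed
  then show ?thesis by blast
qed

end
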